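(* Every h-perfect line graph $G$ has the integer round-up property for the chromatic number; that is, for every $c\in\mathbb{Z}_+^{V(G)}$, $\chi(G,c)=\lceil \chi_f(G,c)\rceil$.
   Context: Graphs are finite, undirected and loopless, and may have multiple edges. The line graph $L(H)$ of a graph $H$ is the simple graph with vertex set $E(H)$ in which two distinct edges of $H$ are adjacent iff they share at least one end (in particular parallel edges of $H$ are adjacent in $L(H)$). A graph $G$ is a line graph if $G=L(H)$ for some graph $H$ ($H$ may have multiple edges). A stable set of $G$ is a set of pairwise non-adjacent vertices; a clique is a set of pairwise adjacent vertices; $\mathcal{S}(G)$ denotes the set of stable sets of $G$. An odd hole is an induced circuit with an odd number of vertices, at least $5$. The stable set polytope $\mathrm{STAB}(G)\subseteq\mathbb{R}^{V(G)}$ is the convex hull of the $0/1$ characteristic vectors of the stable sets of $G$. $G$ is h-perfect if $\mathrm{STAB}(G)$ is the set of all $x\in\mathbb{R}^{V(G)}$ satisfying $x\ge 0$, $\sum_{v\in K}x_v\le 1$ for every clique $K$ of $G$, and $\sum_{v\in V(C)}x_v\le\frac{|V(C)|-1}{2}$ for every odd hole $C$ of $G$. For $c\in\mathbb{Z}_+^{V(G)}$, the weighted chromatic number is $$\chi(G,c)=\min\Big\{\sum_{S\in\mathcal{S}(G)}y_S: y\in\mathbb{Z}_+^{\mathcal{S}(G)},\ \sum_{S\in\mathcal{S}(G):\,v\in S}y_S\ge c_v\ \ \forall v\in V(G)\Big\},$$ and the weighted fractional chromatic number $\chi_f(G,c)$ is the optimum of the same program with $\mathbb{Z}_+$ replaced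 by $\mathbb{Q}_+$. *)

theory Defs
  imports "HOL-Analysis.Analysis" "HOL-Library.Function_Algebras"
begin

subsection \<open>Graphs and line graphs\<close>

record ('v, 'e) multigraph =
  mverts :: "'v set"
  medges :: "'e set"
  ends :: "'e \<Rightarrow> 'v set"

text \<open>Finite, undirected and loopless (every edge has exactly two ends); distinct edges may
  have the same set of ends.\<close>

locale multigraph =
  fixes H :: "('v, 'e) multigraph"
  assumes finite_mverts: "finite (mverts H)"
    and finite_medges: "finite (medges H)"
    and ends_subset: "e \<in> medges H \<Longrightarrow> ends H e \<subseteq> mverts H"
    and card_ends: "e \<in> medges H \<Longrightarrow> card (ends H e) = 2"

text \<open>Simple graphs, with edges given as two-element sets of vertices.\<close>

record 'a sgraph =
  verts :: "'a set"
  edges :: "'a set set"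

locale simple_graph =
  fixes G :: "'a sgraph"
  assumes finite_verts: "finite (verts G)"
    and edge_subset: "e \<in> edges G \<Longrightarrow> e \<subseteq> verts G"
    and card_edge: "e \<in> edges G \<Longrightarrow> card e = 2"

definition adj :: "'a sgraph \<Rightarrow> 'a \<Rightarrow> 'a \<Rightarrow> bool" where
  "adj G u v \<longleftrightarrow> {u, v} \<in> edges G"

definition line_graph :: "('v, 'e) multigraph \<Rightarrow> 'e sgraph" where
  "line_graph H =
    \<lparr>verts = medges H,
     edges = {{e, f} | e f. e \<in> medges H \<and> f \<in> medges H \<and> e \<noteq> f \<and> ends H e \<inter> ends H f \<noteq> {}}\<rparr>"

lemma (in multigraph) simple_graph_line_graph: "simple_graph (line_graph H)"
  by standard (auto simp: line_graph_def finite_medges)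

lemma adj_line_graph:
  "adj (line_graph H) e f \<longleftrightarrow>
    e \<in> medges H \<and> f \<in> medges H \<and> e \<noteq> f \<and> ends H e \<inter> ends H f \<noteq> {}"
  by (auto simp: adj_def line_graph_def doubleton_eq_iff)

definition stable_set :: "'a sgraph \<Rightarrow> 'a set \<Rightarrow> bool" where
  "stable_set G S \<longleftrightarrow> S \<subseteq> verts G \<and> pairwise (\<lambda>u v. \<not> adj G u v) S"

definition clique :: "'a sgraph \<Rightarrow> 'a set \<Rightarrow> bool" where
  "clique G K \<longleftrightarrow> K \<subseteq> verts G \<and> pairwise (adj G) K"

text \<open>An odd hole is represented by its vertex set; \<open>xs\<close> lists the vertices in cyclic order,
  and the equivalence makes the circuit induced.\<close>

definition odd_hole :: "'a sgraph \<Rightarrow> 'a set \<Rightarrow> bool" where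
  "odd_hole G C \<longleftrightarrow>
    (\<exists>xs. distinct xs \<and> set xs = C \<and> C \<subseteq> verts G \<and> 5 \<le> length xs \<and> odd (length xs) \<and>
      (\<forall>i<length xs. \<forall>j<length xs.
        adj G (xs ! i) (xs ! j) \<longleftrightarrow>
          j = Suc i mod length xs \<or> i = Suc j mod length xs))"

subsection \<open>The stable set polytope and h-perfection\<close>

text \<open>The pointwise vector space structure on \<open>'a \<Rightarrow> real\<close>, making \<open>convex hull\<close> available.\<close>

instantiation "fun" :: (type, real_vector) real_vector
begin

definition scaleR_fun :: "real \<Rightarrow> ('a \<Rightarrow> 'b) \<Rightarrow> 'a \<Rightarrow> 'b" where
  "scaleR_fun r f = (\<lambda>x. r *\<^sub>R f x)"

instance
  by standard (auto simp: scaleR_fun_def fun_eq_iff scaleR_add_right scaleR_add_left)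

end

text \<open>For a set \<open>V\<close> of vertices, \<open>\<real>\<^sup>V\<close> is represented by the real functions that vanish
  outside \<open>V\<close>.\<close>

definition STAB :: "'a sgraph \<Rightarrow> ('a \<Rightarrow> real) set" where
  "STAB G = convex hull (indicator ` {S. stable_set G S})"

definition h_perfect :: "'a sgraph \<Rightarrow> bool" where
  "h_perfect G \<longleftrightarrow>
    STAB G = {x. (\<forall>v. v \<notin> verts G \<longrightarrow> x v = 0) \<and>
                 (\<forall>v\<in>verts G. 0 \<le> x v) \<and>
                 (\<forall>K. clique G K \<longrightarrow> (\<Sum>v\<in>K. x v) \<le> 1) \<and>
                 (\<forall>C. odd_hole G C \<longrightarrow> (\<Sum>v\<in>C. x v) \<le> (real (card C) - 1) / 2)}"

subsection \<open>Weighted chromatic numbers\<close>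

text \<open>The feasible solutions of the covering program, with multiplicities in the nonnegative
  part of \<open>'r\<close>. Only the values of \<open>c\<close> on \<open>verts G\<close> and of \<open>y\<close> on stable sets matter.\<close>

definition coverings :: "'a sgraph \<Rightarrow> ('a \<Rightarrow> nat) \<Rightarrow> ('a set \<Rightarrow> 'r::linordered_semidom) set" where
  "coverings G c =
    {y. (\<forall>S. stable_set G S \<longrightarrow> 0 \<le> y S) \<and>
        (\<forall>v\<in>verts G. of_nat (c v) \<le> (\<Sum>S | stable_set G S \<and> v \<in> S. y S))}"

text \<open>On \<open>nat\<close>, the infimum of a nonempty set is its minimum. The fractional optimum is taken
  over rational solutions; its value is recorded as a real number.\<close>

definition chi :: "'a sgraph \<Rightarrow> ('a \<Rightarrow> nat) \<Rightarrow> nat" where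
  "chi G c = (INF y\<in>coverings G c. \<Sum>S | stable_set G S. y S)"

definition chi_f :: "'a sgraph \<Rightarrow> ('a \<Rightarrow> nat) \<Rightarrow> real" where
  "chi_f G c = (INF y\<in>coverings G c. real_of_rat (\<Sum>S | stable_set G S. y S))"

definition integer_round_up :: "'a sgraph \<Rightarrow> bool" where
  "integer_round_up G \<longleftrightarrow> (\<forall>c. int (chi G c) = \<lceil>chi_f G c\<rceil>)"

end

theory Submission
  imports Defs "HOL-Combinatorics.Transposition"
begin

text \<open>Let \<open>k\<close> be the round-up of the fractional chromatic number of \<open>line_graph H\<close>. Counting gives
  two bounds on the weights: at most \<open>k\<close> on the edges at a vertex, and at most \<open>k * (card U - 1) / 2\<close>
  on the edges within a vertex set \<open>U\<close> of odd size. If \<open>line_graph H\<close> is h-perfect, \<open>H\<close> contains no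
  two vertices joined by three internally disjoint paths, two odd ones, not both single edges, and
  an even one: otherwise a third of the sum of the characteristic vectors of the three paths and of
  a matching in them satisfies all constraints but is not in the stable set polytope. So every odd
  ear of an odd circuit is an edge parallel to an edge of the circuit.

  Now colour all edges (with multiplicity) but one, \<open>e = uv\<close>, by induction, with \<open>u\<close> missing the
  colour \<open>\<alpha>\<close> and \<open>v\<close> missing \<open>\<beta>\<close>. If no Kempe change frees a colour for \<open>e\<close>, then the
  \<open>\<alpha>\<close>-\<open>\<beta>\<close> path from \<open>u\<close> leads to \<open>v\<close> and forms with \<open>e\<close> an odd circuit on a vertex set \<open>U\<close>. Let
  \<open>\<gamma>\<close> be another colour and exchange \<open>\<alpha>\<close> and \<open>\<gamma>\<close> on the \<open>\<alpha>\<close>-\<open>\<gamma>\<close> path from \<open>u\<close>; then the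
  \<open>\<gamma>\<close>-\<open>\<beta>\<close> path from \<open>u\<close> leads to \<open>v\<close>, and, all its ears being odd, it runs along the circuit.
  Before the exchange, the \<open>\<alpha>\<close>-\<open>\<gamma>\<close> path leaves \<open>U\<close> at most once. Hence every colour has
  \<open>(card U - 1) / 2\<close> edges within \<open>U\<close>; with \<open>e\<close> this violates the bound for \<open>U\<close>.\<close>

subsection \<open>Matchings\<close>

definition matching :: "('v, 'e) multigraph \<Rightarrow> 'e set \<Rightarrow> bool" where
  "matching H S \<longleftrightarrow> S \<subseteq> medges H \<and> (\<forall>e\<in>S. \<forall>f\<in>S. e \<noteq> f \<longrightarrow> ends H e \<inter> ends H f = {})"

text \<open>Lets paths and colour classes be followed through their vertices, without naming which
  of several parallel edges is meant.\<close>

definition joined :: "('v, 'e) multigraph \<Rightarrow> 'e set \<Rightarrow> 'v \<Rightarrow> 'v \<Rightarrow> bool" where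
  "joined H S x y \<longleftrightarrow> (\<exists>e\<in>S. ends H e = {x, y})"

lemma stable_set_line_graph: "stable_set (line_graph H) S \<longleftrightarrow> matching H S"
  unfolding stable_set_def matching_def adj_line_graph pairwise_def
  by (auto simp: line_graph_def)

lemma joined_sym: "joined H S x y \<Longrightarrow> joined H S y x"
  unfolding joined_def by (simp add: insert_commute)

lemma joined_mono: "joined H S x y \<Longrightarrow> S \<subseteq> S' \<Longrightarrow> joined H S' x y"
  unfolding joined_def by blast

lemma joined_unique:
  assumes "matching H S" "joined H S x y" "joined H S x z"
  shows "y = z"
proof -
  obtain e f where ef: "e \<in> S" "ends H e = {x, y}" "f \<in> S" "ends H f = {x, z}"
    using assms unfolding joined_def by blast
  then have "e = f"
    using assms(1) unfolding matching_def by blast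
  then show ?thesis
    using ef by (metis doubleton_eq_iff)
qed

context multigraph
begin

lemma finite_ends: "e \<in> medges H \<Longrightarrow> finite (ends H e)"
  using card_ends by (metis card.infinite zero_neq_numeral)

lemma finite_matching: "matching H S \<Longrightarrow> finite S"
  using finite_medges finite_subset unfolding matching_def by blast

lemma joined_neq: "joined H S x y \<Longrightarrow> S \<subseteq> medges H \<Longrightarrow> x \<noteq> y"
  unfolding joined_def using card_ends by fastforce

lemma joined_iff_incident:
  assumes "S \<subseteq> medges H"
  shows "(\<exists>y. joined H S x y) \<longleftrightarrow> (\<exists>e\<in>S. x \<in> ends H e)"
proof
  assume "\<exists>e\<in>S. x \<in> ends H e"
  then obtain e where e: "e \<in> S" "x \<in> ends H e" by blast
  then obtain a b where "ends H e = {a, b}"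
    using card_ends assms by (meson card_2_iff subsetD)
  then show "\<exists>y. joined H S x y"
    using e unfolding joined_def by (metis insert_commute insertE singletonD)
qed (auto simp: joined_def)

lemma card_matching_within:
  assumes "matching H S" "F \<subseteq> S" "finite U" "\<And>e. e \<in> F \<Longrightarrow> ends H e \<subseteq> U"
  shows "2 * card F \<le> card U"
proof -
  have F: "finite F" "F \<subseteq> medges H"
    using assms(1,2) finite_subset[OF assms(2) finite_matching] unfolding matching_def by auto
  have "card (\<Union>e\<in>F. ends H e) = (\<Sum>e\<in>F. card (ends H e))"
    using F assms(1,2) finite_ends by (intro card_UN_disjoint) (fastforce simp: matching_def)+
  also have "\<dots> = 2 * card F"
    using F card_ends by (simp add: subset_iff)
  finally show ?thesis
    using card_mono[of U "\<Union>e\<in>F. ends H e"] assms by auto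
qed

end

subsection \<open>Paths of forbidden parities\<close>

lemma card_odd_below: "card {i. odd i \<and> Suc i < n} = (n - 1) div 2"
proof (induction n)
  case (Suc n)
  show ?case
  proof (cases "odd n")
    case True
    then have "{i. odd i \<and> Suc i < Suc n} = {i. odd i \<and> Suc i < n}"
      by (auto simp: less_Suc_eq)
    moreover have "n div 2 = (n - 1) div 2" using True by presburger
    ultimately show ?thesis using Suc by simp
  next
    case False
    show ?thesis
    proof (cases "n = 0")
      case False
      then obtain m where m: "n = Suc m" "odd m" using \<open>\<not> odd n\<close> by (cases n) auto
      then have "{i. odd i \<and> Suc i < Suc n} = insert m {i. odd i \<and> Suc i < n}"
        by (auto simp: less_Suc_eq)
      moreover have "m \<notin> {i. odd i \<and> Suc i < n}" "finite {i. odd i \<and> Suc i < n}"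
        using m by auto
      moreover have "Suc ((n - 1) div 2) = n div 2" using m by presburger
      ultimately show ?thesis using Suc by simp
    qed auto
  qed
qed auto

text \<open>Three paths \<open>V 0\<close>, \<open>V 1\<close>, \<open>V 2\<close> with common ends and otherwise disjoint; the path \<open>V p\<close>
  has \<open>L p\<close> edges, and its \<open>i\<close>-th edge is referred to by the pair \<open>(p, i)\<close>.\<close>

locale theta = multigraph H for H :: "('v, 'e) multigraph" +
  fixes V :: "nat \<Rightarrow> nat \<Rightarrow> 'v" and L :: "nat \<Rightarrow> nat"
  assumes path: "\<And>p i. p < 3 \<Longrightarrow> i < L p \<Longrightarrow> joined H (medges H) (V p i) (V p (Suc i))"
    and V_eq: "\<And>p q i j. p < 3 \<Longrightarrow> q < 3 \<Longrightarrow> i \<le> L p \<Longrightarrow> j \<le> L q \<Longrightarrow> V p i = V q j \<Longrightarrow>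
      p = q \<and> i = j \<or> i = 0 \<and> j = 0 \<or> i = L p \<and> j = L q"
    and V_0: "\<And>p. p < 3 \<Longrightarrow> V p 0 = V 0 0"
    and V_L: "\<And>p. p < 3 \<Longrightarrow> V p (L p) = V 0 (L 0)"
    and odd_L: "odd (L 0)" "odd (L 1)"
    and even_L: "even (L 2)" "0 < L 2"
    and long: "3 \<le> L 0"
begin

definition I :: "(nat \<times> nat) set" where
  "I = (SIGMA p:{..<3}. {..<L p})"

definition edge :: "nat \<times> nat \<Rightarrow> 'e" where
  "edge = (\<lambda>(p, i). SOME e. e \<in> medges H \<and> ends H e = {V p i, V p (Suc i)})"

text \<open>On distinct members of \<open>I\<close> this is adjacency in the line graph, expressed
  by positions only.\<close>

definition N :: "nat \<times> nat \<Rightarrow> nat \<times> nat \<Rightarrow> bool" where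
  "N = (\<lambda>(p, i) (q, j). p = q \<and> (j = Suc i \<or> i = Suc j) \<or> i = 0 \<and> j = 0 \<or>
    Suc i = L p \<and> Suc j = L q)"

text \<open>On an odd path these edges pair up all inner vertices. On the even path the last inner
  vertex stays single, so the last two edges of that path are both left out.\<close>

definition M :: "(nat \<times> nat) set" where
  "M = (SIGMA p:{..<3}. {i. odd i \<and> Suc i < L p})"

text \<open>All constraints of the description of the polytope hold at \<open>x\<close>, but its sum exceeds by
  \<open>1 / 3\<close> the largest size of a matching among the edges of the three paths.\<close>

definition y :: "'e \<Rightarrow> nat" where
  "y f = of_bool (f \<in> edge ` I) + of_bool (f \<in> edge ` M)"

definition x :: "'e \<Rightarrow> real" where
  "x f = real (y f) / 3"

section \<open>Adjacency among the edges of the three paths\<close>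

lemma finite_I: "finite I"
  unfolding I_def by auto

lemma M_sub: "M \<subseteq> I"
  unfolding M_def I_def by auto

lemma three: "p < 3 \<longleftrightarrow> p = 0 \<or> p = 1 \<or> p = (2::nat)"
  by auto

lemma edge:
  assumes "(p, i) \<in> I"
  shows "edge (p, i) \<in> medges H" "ends H (edge (p, i)) = {V p i, V p (Suc i)}"
proof -
  have "\<exists>e. e \<in> medges H \<and> ends H e = {V p i, V p (Suc i)}"
    using path[of p i] assms unfolding I_def joined_def by auto
  from someI_ex[OF this] show "edge (p, i) \<in> medges H"
    "ends H (edge (p, i)) = {V p i, V p (Suc i)}"
    unfolding edge_def by auto
qed

lemma edge_mem: "a \<in> I \<Longrightarrow> edge a \<in> medges H"
  using edge(1) by (cases a) auto

lemma N_sym: "N a b \<Longrightarrow> N b a"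
  unfolding N_def by auto

lemma N_if_meet:
  assumes "a \<in> I" "b \<in> I" "ends H (edge a) \<inter> ends H (edge b) \<noteq> {}"
  shows "a = b \<or> N a b"
proof -
  obtain p i q j where ab: "a = (p, i)" "b = (q, j)" by fastforce
  have lt: "p < 3" "q < 3" "i < L p" "j < L q"
    using assms ab unfolding I_def by auto
  have "V p i = V q j \<or> V p i = V q (Suc j) \<or> V p (Suc i) = V q j \<or> V p (Suc i) = V q (Suc j)"
    using assms edge[of p i] edge[of q j] unfolding ab by auto
  then show ?thesis
    using V_eq[of p q i j] V_eq[of p q i "Suc j"] V_eq[of p q "Suc i" j]
      V_eq[of p q "Suc i" "Suc j"] lt
    unfolding ab N_def by auto
qed

lemma inj_edge: "inj_on edge I"
proof (rule inj_onI)
  fix a b assume ab: "a \<in> I" "b \<in> I" "edge a = edge b"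
  obtain p i q j where eq: "a = (p, i)" "b = (q, j)" by fastforce
  have lt: "p < 3" "q < 3" "i < L p" "j < L q"
    using ab eq unfolding I_def by auto
  have "{V p i, V p (Suc i)} = {V q j, V q (Suc j)}"
    using ab edge[of p i] edge[of q j] unfolding eq by auto
  then consider "V p i = V q j" "V p (Suc i) = V q (Suc j)"
    | "V p i = V q (Suc j)" "V p (Suc i) = V q j"
    by (auto simp: doubleton_eq_iff)
  then show "a = b"
  proof cases
    case 1
    have "p = q \<and> i = j \<or> i = 0 \<and> j = 0"
      using V_eq[OF lt(1,2) _ _ 1(1)] lt by auto
    moreover have "p = q \<and> i = j \<or> Suc i = L p \<and> Suc j = L q"
      using V_eq[OF lt(1,2) _ _ 1(2)] lt by auto
    \<comment> \<open>Distinct paths sharing an edge in this way would both consist of that edge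
      alone; only path 1 can be that short.\<close>
    moreover have "p = q" if "L p = 1" "L q = 1"
      using that lt(1,2) long even_L(1) unfolding three by auto
    ultimately show ?thesis unfolding eq by auto
  next
    case 2
    then show ?thesis
      using V_eq[OF lt(1,2) _ _ 2(1)] V_eq[OF lt(1,2) _ _ 2(2)] lt by auto
  qed
qed

lemma not_N_M: "a \<in> M \<Longrightarrow> b \<in> M \<Longrightarrow> \<not> N a b"
  unfolding M_def N_def by auto

lemma N_M: "(p, i) \<in> M \<Longrightarrow> N (p, i) b \<Longrightarrow> b = (p, Suc i) \<or> b = (p, i - 1)"
  unfolding M_def N_def by (auto split: prod.splits)

section \<open>The values of \<open>y\<close> and the clique constraints\<close>

lemma y_edge: "a \<in> I \<Longrightarrow> y (edge a) = (if a \<in> M then 2 else 1)"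
  unfolding y_def using inj_on_image_mem_iff[OF inj_edge _ M_sub] by auto

lemma y_eq_0: "f \<notin> edge ` I \<Longrightarrow> y f = 0"
  unfolding y_def using M_sub by auto

lemma y_le: "y f \<le> 2"
  unfolding y_def by auto

lemma y_meet:
  assumes "e \<noteq> f" "ends H e \<inter> ends H f \<noteq> {}"
  shows "y e + y f \<le> 3"
proof (cases "e \<in> edge ` I \<and> f \<in> edge ` I")
  case True
  then obtain a b where ab: "a \<in> I" "b \<in> I" "e = edge a" "f = edge b" by blast
  then have "N a b" using N_if_meet[of a b] assms by auto
  then have "\<not> (a \<in> M \<and> b \<in> M)" using not_N_M by blast
  then show ?thesis using ab y_edge by auto
next
  case False
  then show ?thesis using y_eq_0[of e] y_eq_0[of f] y_le[of e] y_le[of f] by auto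
qed

text \<open>The left side is the sum of \<open>y\<close> over the corresponding edges, so this is
  the clique constraint scaled by three. A member of \<open>M\<close> is adjacent only to its two
  neighbours on its path, which are not adjacent to each other; without such a member only the
  number of edges matters.\<close>

lemma N_clique:
  assumes J: "J \<subseteq> I" and N: "\<And>a b. a \<in> J \<Longrightarrow> b \<in> J \<Longrightarrow> a \<noteq> b \<Longrightarrow> N a b"
  shows "card J + card (J \<inter> M) \<le> 3"
proof (cases "J \<inter> M = {}")
  case False
  then obtain p i where a: "(p, i) \<in> J" "(p, i) \<in> M" by auto
  have sub: "J \<subseteq> {(p, i), (p, Suc i), (p, i - 1)}"
    using N[OF a(1)] N_M[OF a(2)] by blast
  have "i > 0" "Suc i < L p" using a(2) unfolding M_def by (auto intro: Nat.gr0I)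
  then have "\<not> N (p, Suc i) (p, i - 1)" unfolding N_def by auto
  moreover have "(p, Suc i) \<noteq> (p, i - 1)" by auto
  ultimately have "J \<subseteq> {(p, i), (p, Suc i)} \<or> J \<subseteq> {(p, i), (p, i - 1)}"
    using N sub by blast
  then obtain b where "J \<subseteq> {(p, i), b}" by blast
  then have "card J \<le> 2"
    using card_mono[of "{(p, i), b}" J] card_insert_le_m1[of 2 "{b}" "(p,i)"] by auto
  moreover have "J \<inter> M \<subseteq> {(p, i)}"
    using N[OF a(1)] a(2) not_N_M by blast
  then have "card (J \<inter> M) \<le> 1"
    using card_mono[of "{(p, i)}" "J \<inter> M"] by auto
  ultimately show ?thesis by simp
next
  case True
  have card3: "card J \<le> 3" if "J \<subseteq> {a, b, c}" for a b c
    using card_mono[OF _ that] card_insert_le_m1[of 3 "{b, c}" a] card_insert_le_m1[of 2 "{c}" b]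
    by auto
  \<comment> \<open>The edges at a common end of the paths form a clique with one edge per
    path.\<close>
  have first: "card J \<le> 3" if "\<And>p i. (p, i) \<in> J \<Longrightarrow> i = 0"
  proof -
    have "J \<subseteq> {(0, 0), (1, 0), (2, 0)}"
      using that J unfolding I_def by (auto simp: three)
    then show ?thesis by (rule card3)
  qed
  have last: "card J \<le> 3" if "\<And>p i. (p, i) \<in> J \<Longrightarrow> Suc i = L p"
  proof -
    have "J \<subseteq> {(0, L 0 - 1), (1, L 1 - 1), (2, L 2 - 1)}"
    proof
      fix a assume a: "a \<in> J"
      obtain p i where pi: "a = (p, i)" by fastforce
      then have "p < 3" "i = L p - 1" using a J that[of p i] unfolding I_def by auto
      then show "a \<in> {(0, L 0 - 1), (1, L 1 - 1), (2, L 2 - 1)}" unfolding pi three by auto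
    qed
    then show ?thesis by (rule card3)
  qed
  \<comment> \<open>The neighbour of such an end edge along its own path lies in \<open>M\<close>,
    hence outside \<open>J\<close>; so the whole clique sits at one common end.\<close>
  have long_end: "card J \<le> 3" if p: "p < 2" "L p \<ge> 3" "(p, i) \<in> J" "i = 0 \<or> Suc i = L p" for p i
  proof -
    have "odd (L p)" using p(1) odd_L by (auto simp: less_2_cases_iff)
    have "card J \<le> 3" if "i = 0"
    proof (rule first)
      fix q j assume qj: "(q, j) \<in> J"
      have "(p, Suc 0) \<notin> J"
        using True p(1,2) unfolding M_def by auto
      then show "j = 0"
        using N[OF p(3) qj] that p(2) qj unfolding N_def by (cases "(p, i) = (q, j)") auto
    qed
    moreover have "card J \<le> 3" if "Suc i = L p"
    proof (rule last)
      fix q j assume qj: "(q, j) \<in> J"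
      have "(p, i - 1) \<notin> J"
        using True p(1,2) that \<open>odd (L p)\<close> unfolding M_def by auto
      then show "Suc j = L q"
        using N[OF p(3) qj] that p(2) qj J unfolding N_def I_def
        by (cases "(p, i) = (q, j)") auto
    qed
    ultimately show ?thesis using p by blast
  qed
  have "card J \<le> 3"
  proof (cases "\<exists>p i. (p, i) \<in> J \<and> i \<noteq> 0 \<and> Suc i \<noteq> L p")
    case True
    then obtain p i where a: "(p, i) \<in> J" "i \<noteq> 0" "Suc i \<noteq> L p" by blast
    then have "p < 3" "Suc i < L p" using J unfolding I_def by auto
    \<comment> \<open>An inner edge outside \<open>M\<close> stands at an even position, so its
      predecessor is in \<open>M\<close> and only its successor is left.\<close>
    then have "even i" using \<open>J \<inter> M = {}\<close> a unfolding M_def by auto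
    then have "(p, i - 1) \<in> M"
      using a(2) \<open>p < 3\<close> \<open>Suc i < L p\<close> unfolding M_def by simp
    then have "(p, i - 1) \<notin> J"
      using \<open>J \<inter> M = {}\<close> by blast
    have "J \<subseteq> {(p, i), (p, Suc i), (p, Suc i)}"
    proof
      fix b assume b: "b \<in> J"
      obtain q j where "b = (q, j)" by fastforce
      then show "b \<in> {(p, i), (p, Suc i), (p, Suc i)}"
        using N[OF a(1) b] a b \<open>(p, i - 1) \<notin> J\<close> unfolding N_def
        by (cases "(p, i) = (q, j)") auto
    qed
    then show ?thesis by (rule card3)
  next
    case False
    show ?thesis
    proof (cases "\<exists>p i. p < 2 \<and> L p \<ge> 3 \<and> (p, i) \<in> J")
      case True
      then show ?thesis using long_end False by blast
    next
      case short: False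
      \<comment> \<open>What remains is a path 1 of length one and the two end edges of the even
        path; if the even path has length two, they form a triangle.\<close>
      have "J \<subseteq> {(1, 0), (2, 0), (2, L 2 - 1)}"
      proof
        fix a assume "a \<in> J"
        then obtain p i where a: "a = (p, i)" "(p, i) \<in> J" by (cases a) auto
        then have "p < 3" "i < L p" using J unfolding I_def by auto
        moreover have "p \<noteq> 0" using short a(2) long by (intro notI) auto
        moreover have "i = 0" if "p = 1"
        proof -
          have "\<not> 3 \<le> L 1"
          proof
            assume "3 \<le> L 1"
            then have "\<exists>p i. p < 2 \<and> 3 \<le> L p \<and> (p, i) \<in> J"
              using a(2) that by (intro exI[of _ p] exI[of _ i]) auto
            then show False using short by blast
          qed
          then have "L 1 = 1" using odd_L(2) by presburger
          then show ?thesis using \<open>i < L p\<close> that by simp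
        qed
        moreover have "i = 0 \<or> Suc i = L p" using False a(2) by blast
        then have "i = 0 \<or> i = L p - 1" by arith
        ultimately show "a \<in> {(1, 0), (2, 0), (2, L 2 - 1)}"
          unfolding a(1) three by blast
      qed
      then show ?thesis by (rule card3)
    qed
  qed
  then show ?thesis using True by simp
qed

lemma sum_x_clique:
  assumes "clique (line_graph H) K"
  shows "(\<Sum>f\<in>K. x f) \<le> 1"
proof -
  define J where "J = {a \<in> I. edge a \<in> K}"
  have K: "K \<subseteq> medges H" "\<And>e f. e \<in> K \<Longrightarrow> f \<in> K \<Longrightarrow> e \<noteq> f \<Longrightarrow> ends H e \<inter> ends H f \<noteq> {}"
    using assms unfolding clique_def pairwise_def adj_line_graph by (auto simp: line_graph_def)
  have fin: "finite K" using K(1) finite_medges finite_subset by blast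
  have J: "J \<subseteq> I" unfolding J_def by auto
  have "card J + card (J \<inter> M) \<le> 3"
  proof (rule N_clique[OF J])
    fix a b assume "a \<in> J" "b \<in> J" "a \<noteq> b"
    then have "ends H (edge a) \<inter> ends H (edge b) \<noteq> {}"
      using K(2)[of "edge a" "edge b"] inj_edge unfolding J_def inj_on_def by blast
    then show "N a b" using N_if_meet[of a b] \<open>a \<in> J\<close> \<open>b \<in> J\<close> \<open>a \<noteq> b\<close> J by blast
  qed
  moreover have "(\<Sum>f\<in>K. y f) = card J + card (J \<inter> M)"
  proof -
    have "(\<Sum>f\<in>K. y f) = (\<Sum>f\<in>edge ` J. y f)"
      using fin by (intro sum.mono_neutral_right) (auto simp: J_def intro: y_eq_0)
    also have "\<dots> = (\<Sum>a\<in>J. y (edge a))"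
      using inj_on_subset[OF inj_edge J] by (simp add: sum.reindex)
    also have "\<dots> = (\<Sum>a\<in>J. 1 + of_bool (a \<in> M))"
      using J y_edge by (intro sum.cong) auto
    also have "\<dots> = card J + card (J \<inter> M)"
      using finite_subset[OF J finite_I] by (simp only: sum.distrib) (simp add: Int_def)
    finally show ?thesis .
  qed
  ultimately have "(\<Sum>f\<in>K. y f) \<le> 3" by simp
  then have "real (\<Sum>f\<in>K. y f) \<le> 3" by (metis of_nat_le_iff of_nat_numeral)
  then show ?thesis unfolding x_def by (simp flip: sum_divide_distrib)
qed

section \<open>The odd hole constraints\<close>

text \<open>Consecutive values of \<open>y\<close> around a hole of length \<open>n\<close> sum to
  at most three. Two pairs with sum at most two bring twice the total down to
  \<open>3 * n - 2\<close>, and since this number is odd, down to \<open>3 * n - 3\<close>, which is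
  the constraint.\<close>

lemma sum_x_hole:
  assumes "odd_hole (line_graph H) C"
  shows "(\<Sum>f\<in>C. x f) \<le> (real (card C) - 1) / 2"
proof -
  obtain xs where xs: "distinct xs" "set xs = C" "C \<subseteq> verts (line_graph H)" "5 \<le> length xs"
      "odd (length xs)"
    and adj_xs: "\<And>i j. i < length xs \<Longrightarrow> j < length xs \<Longrightarrow>
      adj (line_graph H) (xs ! i) (xs ! j) \<longleftrightarrow> j = Suc i mod length xs \<or> i = Suc j mod length xs"
    using assms unfolding odd_hole_def by blast
  define n where "n = length xs"
  define g where "g i = xs ! (i mod n)" for i
  have n: "5 \<le> n" "odd n" "0 < n"
    using xs unfolding n_def by auto
  have g_meet: "g i \<noteq> g (Suc i)" "ends H (g i) \<inter> ends H (g (Suc i)) \<noteq> {}" for i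
  proof -
    have "adj (line_graph H) (xs ! (i mod n)) (xs ! (Suc i mod n))"
      using adj_xs[of "i mod n" "Suc i mod n"] n by (simp add: n_def[symmetric] mod_Suc_eq)
    then show "g i \<noteq> g (Suc i)" "ends H (g i) \<inter> ends H (g (Suc i)) \<noteq> {}"
      unfolding adj_line_graph g_def by auto
  qed
  have g_eq: "i mod n = j mod n" if "g i = g j" for i j
    using that n xs(1) unfolding g_def n_def by (simp add: nth_eq_iff_index_eq)
  have g_cong: "g i = g j" if "i mod n = j mod n" for i j
    using that unfolding g_def by simp
  have g_Suc_cong: "g (Suc i) = g (Suc j)" if "i mod n = j mod n" for i j
    using that by (intro g_cong) (metis mod_Suc_eq)
  have shift_neq: "(i + a) mod n \<noteq> i mod n" if "0 < a" "a < n" for i a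
  proof
    assume "(i + a) mod n = i mod n"
    then have "n dvd (i + a) - i" by (intro mod_eq_dvd_iff_nat[THEN iffD1]) auto
    then show False using that by (auto dest: dvd_imp_le)
  qed
  define bad where "bad i \<longleftrightarrow> y (g i) + y (g (Suc i)) \<le> 2" for i
  have "\<exists>i j. i < n \<and> j < n \<and> i \<noteq> j \<and> bad i \<and> bad j"
  proof (rule ccontr)
    assume neg: "\<nexists>i j. i < n \<and> j < n \<and> i \<noteq> j \<and> bad i \<and> bad j"
    have bad_unique: "i mod n = j mod n" if "bad i" "bad j" for i j
    proof -
      have "bad (i mod n)" "bad (j mod n)"
        using that g_cong[of i "i mod n"] g_Suc_cong[of i "i mod n"]
          g_cong[of j "j mod n"] g_Suc_cong[of j "j mod n"] unfolding bad_def by auto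
      then show ?thesis using neg n(3) mod_less_divisor by blast
    qed
    \<comment> \<open>A member of the hole off the three paths has value zero, which makes both
      pairs containing it bad.\<close>
    have "g i \<in> edge ` I" for i
    proof (rule ccontr)
      assume "g i \<notin> edge ` I"
      moreover have "g (i + n) = g i" by (rule g_cong) simp
      ultimately have "y (g (i + n)) = 0" using y_eq_0 by simp
      moreover have "i + n = Suc (i + n - 1)" using n by simp
      ultimately have "bad (i + n)" "bad (i + n - 1)"
        using y_le unfolding bad_def by (metis add_0 add_0_right)+
      from bad_unique[OF this] show False
        using shift_neq[of 1 "i + n - 1"] n by simp
    qed
    then have "\<exists>a. a \<in> I \<and> g i = edge a" for i by blast
    then obtain \<phi> where \<phi>: "\<And>i. \<phi> i \<in> I" "\<And>i. g i = edge (\<phi> i)" by metis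
    have \<phi>_eq: "i mod n = j mod n" if "\<phi> i = \<phi> j" for i j
      using that \<phi>(2) g_eq by metis
    have \<phi>_step: "\<phi> i \<noteq> \<phi> (Suc (Suc i))" for i
    proof
      assume "\<phi> i = \<phi> (Suc (Suc i))"
      then have "(i + 2) mod n = i mod n" using \<phi>_eq by (metis add_2_eq_Suc')
      then show False using shift_neq[of 2 i] n(1) by linarith
    qed
    have \<phi>_cong: "\<phi> i = \<phi> j" if "i mod n = j mod n" for i j
      using g_cong[OF that] \<phi> inj_edge unfolding inj_on_def by metis
    have N_\<phi>: "N (\<phi> i) (\<phi> (Suc i))" for i
      using N_if_meet[of "\<phi> i" "\<phi> (Suc i)"] g_meet[of i] \<phi> by auto
    have bad: "bad i" if "\<phi> i \<notin> M" "\<phi> (Suc i) \<notin> M" for i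
      using that \<phi> y_edge unfolding bad_def by auto
    have "\<exists>k. \<phi> k \<in> M"
    proof (rule ccontr)
      assume "\<nexists>k. \<phi> k \<in> M"
      then have "bad 0" "bad 1" using bad by auto
      from bad_unique[OF this] show False using n by auto
    qed
    then obtain p i0 where i0: "(p, i0) \<in> M" "(p, i0) \<in> range \<phi>"
      by (metis rangeI surj_pair)
    \<comment> \<open>Beyond the first and beyond the last member of \<open>M\<close> that the hole
      meets on path \<open>p\<close>, two consecutive members of the hole lie outside
      \<open>M\<close>; this gives a bad pair on either side.\<close>
    define J where "J = {i. (p, i) \<in> M \<and> (p, i) \<in> range \<phi>}"
    have "J \<subseteq> {..<L p}" unfolding J_def M_def by auto
    then have J: "finite J" "J \<noteq> {}"
      using i0 finite_subset unfolding J_def by auto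
    define lo where "lo = Min J"
    define hi where "hi = Max J"
    have lo: "lo \<in> J" "\<And>i. i \<in> J \<Longrightarrow> lo \<le> i" and hi: "hi \<in> J" "\<And>i. i \<in> J \<Longrightarrow> i \<le> hi"
      using J unfolding lo_def hi_def by auto
    \<comment> \<open>A member of \<open>M\<close> has only two neighbours among the path edges, so
      the hole passes through both; \<open>h\<close> is the member of the hole one step beyond
      \<open>b\<close>.\<close>
    have neighbour: "\<exists>r h. {\<phi> r, \<phi> (Suc r)} = {b, h} \<and> N h b \<and> h \<noteq> (p, i) \<and> h \<in> range \<phi> \<and> b \<notin> M"
      if i: "i \<in> J" and b: "b = (p, Suc i) \<or> b = (p, i - 1)" for i b
    proof -
      obtain k0 where "\<phi> k0 = (p, i)" using i unfolding J_def by auto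
      \<comment> \<open>A full turn is added so that two steps back stay within the natural
        numbers.\<close>
      then have "\<phi> (k0 + n) = (p, i)" using \<phi>_cong[of "k0 + n" k0] by simp
      moreover have "k0 + n = Suc (Suc (k0 + n - 2))" using n by simp
      ultimately obtain k where k: "\<phi> (Suc (Suc k)) = (p, i)" by metis
      have i_M: "(p, i) \<in> M" using i unfolding J_def by simp
      have nb: "N (p, i) (\<phi> (Suc k))" "N (p, i) (\<phi> (Suc (Suc (Suc k))))"
        using N_\<phi>[of "Suc k"] N_\<phi>[of "Suc (Suc k)"] N_sym k by auto
      then have "b = \<phi> (Suc k) \<or> b = \<phi> (Suc (Suc (Suc k)))"
        using N_M[OF i_M] b \<phi>_step[of "Suc k"] by metis
      then show ?thesis
      proof
        assume b: "b = \<phi> (Suc k)"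
        have "\<phi> k \<noteq> (p, i)"
          using \<phi>_step[of k] k by simp
        then show ?thesis
          using N_\<phi>[of k] not_N_M[OF i_M] nb(1) unfolding b by (metis insert_commute rangeI)
      next
        assume b: "b = \<phi> (Suc (Suc (Suc k)))"
        have "\<phi> (Suc (Suc (Suc (Suc k)))) \<noteq> (p, i)"
          using \<phi>_step[of "Suc (Suc k)"] k by simp
        then show ?thesis
          using N_\<phi>[of "Suc (Suc (Suc k))"] N_sym not_N_M[OF i_M] nb(2) unfolding b
          by (metis rangeI)
      qed
    qed
    obtain r h where r: "{\<phi> r, \<phi> (Suc r)} = {(p, Suc hi), h}" "N h (p, Suc hi)" "h \<noteq> (p, hi)"
        "h \<in> range \<phi>" "(p, Suc hi) \<notin> M"
      using neighbour[OF hi(1)] by blast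
    obtain r' h' where r': "{\<phi> r', \<phi> (Suc r')} = {(p, lo - 1), h'}" "N h' (p, lo - 1)"
        "h' \<noteq> (p, lo)" "h' \<in> range \<phi>" "(p, lo - 1) \<notin> M"
      using neighbour[OF lo(1)] by blast
    have lo_hi: "0 < lo" "Suc lo < L p" "lo \<le> hi"
      using lo(1) hi(2) unfolding J_def M_def by (auto intro: Nat.gr0I)
    have "h \<notin> M"
    proof
      assume hM: "h \<in> M"
      obtain q j where h: "h = (q, j)" by fastforce
      then have "p = q" "Suc hi = Suc j \<or> Suc hi = j - 1"
        using N_M[of q j] hM r(2) by auto
      moreover from this have "j \<in> J" using hM r(4) h unfolding J_def by auto
      ultimately show False using hi(2)[of j] h r(3) by auto
    qed
    moreover have "h' \<notin> M"
    proof
      assume hM: "h' \<in> M"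
      obtain q j where h: "h' = (q, j)" by fastforce
      then have "p = q" "lo - 1 = Suc j \<or> lo - 1 = j - 1"
        using N_M[of q j] hM r'(2) by auto
      moreover from this have "j \<in> J" using hM r'(4) h unfolding J_def by auto
      moreover have "0 < j" using hM h unfolding M_def by (auto intro: Nat.gr0I)
      ultimately show False using lo(2)[of j] h r'(3) lo_hi by auto
    qed
    ultimately have "bad r" "bad r'"
      using bad[of r] bad[of r'] r(1,5) r'(1,5) by (metis insert_iff singleton_iff)+
    \<comment> \<open>If the two bad pairs were one, the edges just below \<open>lo\<close> and just
      above \<open>hi\<close> would be adjacent, but they lie at least two positions apart on path
      \<open>p\<close>.\<close>
    from bad_unique[OF this] have "{\<phi> r, \<phi> (Suc r)} = {\<phi> r', \<phi> (Suc r')}"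
      using \<phi>_cong[of r r'] \<phi>_cong[of "Suc r" "Suc r'"] by (metis mod_Suc_eq)
    then have "h = (p, lo - 1)"
      using r(1) r'(1) lo_hi by (auto simp: doubleton_eq_iff)
    then show False
      using r(2) lo_hi unfolding N_def by auto
  qed
  then obtain i j where ij: "i < n" "j < n" "i \<noteq> j" "bad i" "bad j" by blast
  have "(\<Sum>f\<in>C. y f) = (\<Sum>i<n. y (g i))"
    using sum.reindex_bij_betw[OF bij_betw_nth[OF xs(1), of "{..<n}" C], of y] xs(2)
    unfolding g_def n_def by simp
  moreover have "(\<Sum>i<n. y (g (Suc i))) = (\<Sum>i<n. y (g i))"
  proof -
    have "(\<Sum>i<Suc n. y (g i)) = y (g 0) + (\<Sum>i<n. y (g (Suc i)))"
      by (rule sum.lessThan_Suc_shift)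
    moreover have "g n = g 0" by (rule g_cong) simp
    ultimately show ?thesis by simp
  qed
  ultimately have "2 * (\<Sum>f\<in>C. y f) = (\<Sum>i<n. y (g i) + y (g (Suc i)))"
    by (simp add: sum.distrib)
  also have "\<dots> \<le> (\<Sum>k<n. if k = i \<or> k = j then 2 else 3)"
    using y_meet[OF g_meet] ij unfolding bad_def by (intro sum_mono) auto
  also have "\<dots> + 2 = 3 * n"
  proof -
    have "(\<Sum>k<n. if k = i \<or> k = j then 2 else 3) + (\<Sum>k<n. if k = i then 1 else 0) +
        (\<Sum>k<n. if k = j then 1 else 0) = (\<Sum>k<n. 3::nat)"
      unfolding sum.distrib[symmetric] using ij(3) by (intro sum.cong) auto
    then show ?thesis using ij by simp
  qed
  finally have "2 * (\<Sum>f\<in>C. y f) + 2 \<le> 3 * n" by simp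
  moreover have "2 * (\<Sum>f\<in>C. y f) + 2 \<noteq> 3 * n"
    using n(2) by presburger
  ultimately have "2 * (\<Sum>f\<in>C. y f) + 3 \<le> 3 * n" by simp
  then have "real (2 * (\<Sum>f\<in>C. y f) + 3) \<le> real (3 * n)"
    by (simp only: of_nat_le_iff)
  moreover have "card C = n" using xs distinct_card n_def by blast
  moreover have "(\<Sum>f\<in>C. x f) = real (\<Sum>f\<in>C. y f) / 3"
    unfolding x_def by (simp add: sum_divide_distrib)
  ultimately show ?thesis by simp
qed

section \<open>Separation from the stable set polytope\<close>

lemma sum_y: "(\<Sum>f\<in>edge ` I. y f) = card I + card M"
proof -
  have "(\<Sum>f\<in>edge ` I. y f) = (\<Sum>a\<in>I. y (edge a))"
    using inj_edge by (simp add: sum.reindex)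
  also have "\<dots> = (\<Sum>a\<in>I. 1 + of_bool (a \<in> M))"
    using y_edge by (intro sum.cong) auto
  also have "\<dots> = card I + card (I \<inter> M)"
    using finite_I by (simp only: sum.distrib) (simp add: Int_def)
  finally show ?thesis using M_sub by (simp add: Int_absorb1)
qed

lemma lessThan_three: "{..<3} = {0, 1, 2::nat}"
  by auto

text \<open>Every matching has at most \<open>m\<close> edges on the three paths, so the polytope
  lies in the half-space where these coordinates sum to at most \<open>m\<close>; those of
  \<open>x\<close> sum to \<open>m + 1 / 3\<close>.\<close>

lemma not_h_perfect: "\<not> h_perfect (line_graph H)"
proof
  assume "h_perfect (line_graph H)"
  moreover have "x v = 0" if "v \<notin> medges H" for v
  proof -
    have "v \<notin> edge ` I" using that edge_mem by blast
    then show ?thesis unfolding x_def using y_eq_0 by simp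
  qed
  moreover have "0 \<le> x v" for v unfolding x_def by simp
  ultimately have x_STAB: "x \<in> STAB (line_graph H)"
    using sum_x_clique sum_x_hole unfolding h_perfect_def by (auto simp: line_graph_def)
  obtain a b c where abc: "L 0 = 2 * a + 1" "L 1 = 2 * b + 1" "L 2 = 2 * c + 2"
  proof -
    have "\<exists>c. L 2 = 2 * c + 2"
      using even_L by (intro exI[of _ "L 2 div 2 - 1"]) auto
    then show ?thesis using odd_L that by (auto elim!: oddE)
  qed
  define m where "m = a + b + c + 1"
  \<comment> \<open>The vertices of the three paths, with the common ends listed once; there are at
    most \<open>2 * m + 1\<close>, which leaves room for \<open>m\<close> disjoint edges.\<close>
  define W where "W = V 0 ` {..L 0} \<union> V 1 ` {1..<L 1} \<union> V 2 ` {1..<L 2}"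
  have "card W \<le> card (V 0 ` {..L 0}) + card (V 1 ` {1..<L 1}) + card (V 2 ` {1..<L 2})"
    unfolding W_def by (meson add_le_mono card_Un_le le_refl le_trans)
  also have "\<dots> \<le> card {..L 0} + card {1..<L 1} + card {1..<L 2}"
    by (intro add_mono card_image_le) auto
  finally have card_W: "card W \<le> 2 * m + 1"
    using abc unfolding m_def by simp
  have V_W: "V p i \<in> W" if "p < 3" "i \<le> L p" for p i
  proof (cases "i = 0 \<or> i = L p")
    case True
    then have "V p i = V 0 0 \<or> V p i = V 0 (L 0)" using V_0[OF that(1)] V_L[OF that(1)] by auto
    then show ?thesis unfolding W_def by auto
  next
    case False
    then have "i \<in> {1..<L p}" "i \<in> {..L 0} \<or> p \<noteq> 0" using that by auto
    then show ?thesis using that(1) unfolding W_def three by blast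
  qed
  have edge_W: "ends H (edge a) \<subseteq> W" if a: "a \<in> I" for a
  proof -
    obtain p i where pi: "a = (p, i)" by fastforce
    then have "p < 3" "i < L p" using a unfolding I_def by auto
    then show ?thesis
      using edge(2)[of p i] V_W[of p i] V_W[of p "Suc i"] a unfolding pi by auto
  qed
  have "finite W" unfolding W_def by auto
  have bound: "card (S \<inter> edge ` I) \<le> m" if "matching H S" for S
  proof -
    have "2 * card (S \<inter> edge ` I) \<le> card W"
      using edge_W by (intro card_matching_within[OF that _ \<open>finite W\<close>]) auto
    then show ?thesis using card_W by simp
  qed
  have "STAB (line_graph H) \<subseteq> {z. (\<Sum>f\<in>edge ` I. z f) \<le> real m}"
    unfolding STAB_def
  proof (rule hull_minimal)
    show "indicator ` {S. stable_set (line_graph H) S} \<subseteq> {z. (\<Sum>f\<in>edge ` I. z f) \<le> real m}"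
      using bound finite_I by (auto simp: stable_set_line_graph sum.inter_restrict[symmetric]
          indicator_def Int_commute)
    show "convex {z. (\<Sum>f\<in>edge ` I. z f) \<le> real m}"
      unfolding convex_def
      by (auto simp: scaleR_fun_def sum.distrib sum_distrib_left[symmetric] intro: convex_bound_le)
  qed
  then have "(\<Sum>f\<in>edge ` I. x f) \<le> real m" using x_STAB by auto
  then have "real (\<Sum>f\<in>edge ` I. y f) \<le> real (3 * m)"
    unfolding x_def by (simp add: sum_divide_distrib[symmetric])
  then have "card I + card M \<le> 3 * m"
    unfolding sum_y using of_nat_le_iff by blast
  moreover have "card I = L 0 + L 1 + L 2"
    unfolding I_def lessThan_three by (subst card_SigmaI) auto
  moreover have "card M = (L 0 - 1) div 2 + (L 1 - 1) div 2 + (L 2 - 1) div 2"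
  proof -
    have "finite {i. odd i \<and> Suc i < n}" for n
      by (rule finite_subset[of _ "{..<n}"]) auto
    then show ?thesis
      unfolding M_def lessThan_three by (subst card_SigmaI) (auto simp: card_odd_below)
  qed
  ultimately show False unfolding m_def abc by simp
qed

end

subsection \<open>Ears of odd circuits\<close>

definition is_path :: "('v, 'e) multigraph \<Rightarrow> (nat \<Rightarrow> 'v) \<Rightarrow> nat \<Rightarrow> bool" where
  "is_path H f l \<longleftrightarrow> inj_on f {..l} \<and> (\<forall>i<l. joined H (medges H) (f i) (f (Suc i)))"

definition odd_circuit :: "('v, 'e) multigraph \<Rightarrow> 'v list \<Rightarrow> bool" where
  "odd_circuit H s \<longleftrightarrow> distinct s \<and> odd (length s) \<and> 3 \<le> length s \<and>
    (\<forall>i<length s. joined H (medges H) (s ! i) (s ! (Suc i mod length s)))"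

text \<open>The ears of the circuit \<open>s\<close> considered here are segments of \<open>t\<close> from \<open>a\<close> to \<open>b\<close>.\<close>

definition ear_free :: "('v, 'e) multigraph \<Rightarrow> bool" where
  "ear_free H \<longleftrightarrow> (\<forall>s t a b. odd_circuit H s \<longrightarrow> distinct t \<longrightarrow>
    (\<forall>i. Suc i < length t \<longrightarrow> joined H (medges H) (t ! i) (t ! Suc i)) \<longrightarrow>
    a < b \<longrightarrow> b < length t \<longrightarrow> t ! a \<in> set s \<longrightarrow> t ! b \<in> set s \<longrightarrow>
    (\<forall>i. a < i \<longrightarrow> i < b \<longrightarrow> t ! i \<notin> set s) \<longrightarrow> odd (b - a) \<longrightarrow>
    b = Suc a \<and> (\<exists>i<length s. {t ! a, t ! b} = {s ! i, s ! (Suc i mod length s)}))"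

context multigraph
begin

text \<open>Numbering the paths turns the hypotheses into the locale \<open>theta\<close>, with
  \<open>f\<close> as the odd path that has to be long.\<close>

lemma not_h_perfect_if_paths:
  assumes "is_path H f lf" "is_path H g lg" "is_path H h lh"
    and "f 0 = g 0" "f 0 = h 0" "f lf = g lg" "f lf = h lh"
    and "\<And>i j. i \<le> lf \<Longrightarrow> j \<le> lg \<Longrightarrow> f i = g j \<Longrightarrow> i = 0 \<and> j = 0 \<or> i = lf \<and> j = lg"
    and "\<And>i j. i \<le> lf \<Longrightarrow> j \<le> lh \<Longrightarrow> f i = h j \<Longrightarrow> i = 0 \<and> j = 0 \<or> i = lf \<and> j = lh"
    and "\<And>i j. i \<le> lg \<Longrightarrow> j \<le> lh \<Longrightarrow> g i = h j \<Longrightarrow> i = 0 \<and> j = 0 \<or> i = lg \<and> j = lh"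
    and "odd lf" "odd lg" "even lh" "0 < lh" "3 \<le> lf"
  shows "\<not> h_perfect (line_graph H)"
proof -
  define V where "V p = (if p = 0 then f else if p = 1 then g else h)" for p :: nat
  define L where "L p = (if p = 0 then lf else if p = 1 then lg else lh)" for p :: nat
  have inj: "i = j" if "is_path H f' l" "i \<le> l" "j \<le> l" "f' i = f' j" for f' l i j
    using that unfolding is_path_def inj_on_def by auto
  have cases: "p = 0 \<or> p = 1 \<or> p = 2" if "p < 3" for p :: nat
    using that by auto
  have "theta H V L"
  proof
    fix p i assume "p < 3" "i < L p"
    then show "joined H (medges H) (V p i) (V p (Suc i))"
      using assms(1-3) cases[OF \<open>p < 3\<close>] unfolding V_def L_def is_path_def
      by (auto split: if_splits)
  next
    fix p q i j
    assume pq: "p < 3" "q < 3" and ij: "i \<le> L p" "j \<le> L q" "V p i = V q j"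
    from cases[OF pq(1)] cases[OF pq(2)]
    show "p = q \<and> i = j \<or> i = 0 \<and> j = 0 \<or> i = L p \<and> j = L q"
    proof (elim disjE)
      assume [simp]: "p = 0" "q = 0"
      show ?thesis using inj[OF assms(1), of i j] ij unfolding V_def L_def by simp
    next
      assume [simp]: "p = 0" "q = 1"
      show ?thesis using assms(8)[of i j] ij unfolding V_def L_def by simp
    next
      assume [simp]: "p = 0" "q = 2"
      show ?thesis using assms(9)[of i j] ij unfolding V_def L_def by simp
    next
      assume [simp]: "p = 1" "q = 0"
      show ?thesis using assms(8)[of j i] ij unfolding V_def L_def by auto
    next
      assume [simp]: "p = 1" "q = 1"
      show ?thesis using inj[OF assms(2), of i j] ij unfolding V_def L_def by simp
    next
      assume [simp]: "p = 1" "q = 2"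
      show ?thesis using assms(10)[of i j] ij unfolding V_def L_def by simp
    next
      assume [simp]: "p = 2" "q = 0"
      show ?thesis using assms(9)[of j i] ij unfolding V_def L_def by auto
    next
      assume [simp]: "p = 2" "q = 1"
      show ?thesis using assms(10)[of j i] ij unfolding V_def L_def by auto
    next
      assume [simp]: "p = 2" "q = 2"
      show ?thesis using inj[OF assms(3), of i j] ij unfolding V_def L_def by simp
    qed
  next
    fix p :: nat assume "p < 3"
    show "V p 0 = V 0 0" using assms(4,5) unfolding V_def by simp
    show "V p (L p) = V 0 (L 0)" using assms(6,7) unfolding V_def L_def by simp
  qed (use assms(11-15) in \<open>simp_all add: L_def\<close>)
  then show ?thesis by (rule theta.not_h_perfect)
qed

text \<open>The obstruction is symmetric in \<open>f\<close> and \<open>g\<close>, so neither odd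
  path can reach length three.\<close>

lemma odd_paths_trivial:
  assumes "h_perfect (line_graph H)"
    and paths: "is_path H f lf" "is_path H g lg" "is_path H h lh"
      "f 0 = g 0" "f 0 = h 0" "f lf = g lg" "f lf = h lh"
    and fg: "\<And>i j. i \<le> lf \<Longrightarrow> j \<le> lg \<Longrightarrow> f i = g j \<Longrightarrow> i = 0 \<and> j = 0 \<or> i = lf \<and> j = lg"
    and fh: "\<And>i j. i \<le> lf \<Longrightarrow> j \<le> lh \<Longrightarrow> f i = h j \<Longrightarrow> i = 0 \<and> j = 0 \<or> i = lf \<and> j = lh"
    and gh: "\<And>i j. i \<le> lg \<Longrightarrow> j \<le> lh \<Longrightarrow> g i = h j \<Longrightarrow> i = 0 \<and> j = 0 \<or> i = lg \<and> j = lh"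
    and "odd lf" "odd lg" "even lh" "0 < lh"
  shows "lf = 1 \<and> lg = 1"
proof -
  have "\<not> 3 \<le> lf"
    using not_h_perfect_if_paths[OF paths fg fh gh] assms by blast
  moreover have "\<not> 3 \<le> lg"
  proof
    assume "3 \<le> lg"
    moreover have "i = 0 \<and> j = 0 \<or> i = lg \<and> j = lf" if "i \<le> lg" "j \<le> lf" "g i = f j" for i j
      using fg[of j i] that by auto
    ultimately show False
      using not_h_perfect_if_paths[OF paths(2,1,3) paths(4)[symmetric]
          trans[OF paths(4)[symmetric] paths(5)] paths(6)[symmetric]
          trans[OF paths(6)[symmetric] paths(7)] _ gh fh] assms by blast
  qed
  ultimately show ?thesis using \<open>odd lf\<close> \<open>odd lg\<close> by presburger
qed

lemma joined_cyclic:
  assumes "odd_circuit H s"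
  shows "Suc i < length s \<Longrightarrow> joined H (medges H) (s ! i) (s ! Suc i)"
    and "joined H (medges H) (s ! 0) (s ! (length s - 1))"
proof -
  have s: "\<And>i. i < length s \<Longrightarrow> joined H (medges H) (s ! i) (s ! (Suc i mod length s))" "3 \<le> length s"
    using assms unfolding odd_circuit_def by auto
  show "Suc i < length s \<Longrightarrow> joined H (medges H) (s ! i) (s ! Suc i)"
    using s(1)[of i] by simp
  show "joined H (medges H) (s ! 0) (s ! (length s - 1))"
  proof -
    have "Suc (length s - 1) = length s" using s(2) by simp
    then have "joined H (medges H) (s ! (length s - 1)) (s ! 0)"
      using s(1)[of "length s - 1"] by simp
    then show ?thesis by (rule joined_sym)
  qed
qed

text \<open>The ends of the ear cut the circuit into two arcs. The circuit being odd, one arc is odd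
  and the other even; together with the ear they form the forbidden configuration unless the ear and
  the odd arc are single edges.\<close>

lemma ear_from_start:
  assumes hp: "h_perfect (line_graph H)"
    and s: "odd_circuit H s"
    and t: "distinct t" "\<And>i. Suc i < length t \<Longrightarrow> joined H (medges H) (t ! i) (t ! Suc i)"
    and ab: "a < b" "b < length t" "t ! a = s ! 0" "t ! b \<in> set s"
    and inner: "\<And>i. a < i \<Longrightarrow> i < b \<Longrightarrow> t ! i \<notin> set s"
    and odd_ab: "odd (b - a)"
  shows "b = Suc a \<and> (\<exists>i<length s. {t ! a, t ! b} = {s ! i, s ! (Suc i mod length s)})"
proof -
  define n where "n = length s"
  have n: "distinct s" "odd n" "3 \<le> n" using s unfolding odd_circuit_def n_def by auto
  have s_eq: "i = j" if "s ! i = s ! j" "i < n" "j < n" for i j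
    using that n(1) unfolding n_def by (simp add: nth_eq_iff_index_eq)
  obtain l where l: "l < n" "t ! b = s ! l"
    using ab(4) unfolding n_def by (auto simp: in_set_conv_nth)
  have "t ! b \<noteq> t ! a" using nth_eq_iff_index_eq[OF t(1), of b a] ab(1,2) by simp
  then have "0 < l" using l ab(3) by (cases l) auto
  define D where "D = b - a"
  define ear where "ear i = t ! (a + i)" for i
  \<comment> \<open>The second arc runs backwards from \<open>s ! 0\<close>; its start is treated
    apart because index \<open>n\<close> is out of range.\<close>
  define bwd where "bwd i = (if i = 0 then s ! 0 else s ! (n - i))" for i
  have ear: "is_path H ear D" "ear 0 = s ! 0" "ear D = s ! l"
  proof -
    have "inj_on ear {..D}"
      using t(1) ab unfolding inj_on_def ear_def D_def by (simp add: nth_eq_iff_index_eq)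
    moreover have "joined H (medges H) (ear i) (ear (Suc i))" if "i < D" for i
      using that t(2)[of "a + i"] ab unfolding ear_def D_def by auto
    ultimately show "is_path H ear D" unfolding is_path_def by blast
  qed (use ab l in \<open>auto simp: ear_def D_def\<close>)
  have ear_in: "i = 0 \<or> i = D" if "i \<le> D" "ear i \<in> set s" for i
    using inner[of "a + i"] that ab unfolding ear_def D_def by force
  have fwd: "is_path H ((!) s) l"
    using joined_cyclic(1)[OF s] s_eq l unfolding is_path_def inj_on_def n_def by auto
  have bwd: "is_path H bwd (n - l)"
  proof -
    have "inj_on bwd {..n - l}"
    proof (rule inj_onI)
      fix i j assume ij: "i \<in> {..n - l}" "j \<in> {..n - l}" "bwd i = bwd j"
      then have "(if i = 0 then 0 else n - i) = (if j = 0 then 0 else n - j)"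
        using s_eq[of "if i = 0 then 0 else n - i" "if j = 0 then 0 else n - j"] n l
        unfolding bwd_def by (auto split: if_splits)
      then show "i = j" using ij l \<open>0 < l\<close> by (auto split: if_splits)
    qed
    moreover have "joined H (medges H) (bwd i) (bwd (Suc i))" if "i < n - l" for i
    proof (cases "i = 0")
      case True
      then show ?thesis
        using joined_cyclic(2)[OF s] unfolding bwd_def n_def by simp
    next
      case False
      then have "joined H (medges H) (s ! (n - Suc i)) (s ! Suc (n - Suc i))"
        using that joined_cyclic(1)[OF s, of "n - Suc i"] unfolding n_def by auto
      moreover have "Suc (n - Suc i) = n - i" using that by simp
      ultimately show ?thesis using False joined_sym unfolding bwd_def by fastforce
    qed
    ultimately show ?thesis unfolding is_path_def by blast
  qed
  have bwd_0: "bwd 0 = s ! 0"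
    unfolding bwd_def by simp
  have bwd_l: "bwd (n - l) = s ! l"
    using l unfolding bwd_def by simp
  have bwd_eq: "i = 0 \<and> j = 0 \<or> i = l \<and> j = n - l" if "i \<le> l" "j \<le> n - l" "s ! i = bwd j" for i j
    using s_eq[of i "if j = 0 then 0 else n - j"] that l \<open>0 < l\<close> unfolding bwd_def
    by (auto split: if_splits)
  have ear_fwd: "i = 0 \<and> j = 0 \<or> i = D \<and> j = l" if "i \<le> D" "j \<le> l" "ear i = s ! j" for i j
  proof -
    have "i = 0 \<or> i = D" using ear_in that l unfolding n_def by simp
    then show ?thesis
    proof
      assume "i = 0"
      then show ?thesis using that ear(2) s_eq[of 0 j] l by simp
    next
      assume "i = D"
      then show ?thesis using that ear(3) s_eq[of l j] l by simp
    qed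
  qed
  have ear_bwd: "i = 0 \<and> j = 0 \<or> i = D \<and> j = n - l" if "i \<le> D" "j \<le> n - l" "ear i = bwd j" for i j
  proof -
    have "bwd j \<in> set s" using that l n unfolding bwd_def n_def by (auto intro!: nth_mem)
    then have "i = 0 \<or> i = D" using ear_in that by simp
    then show ?thesis
    proof
      assume "i = 0"
      then show ?thesis using that ear(2) bwd_eq[of 0 j] \<open>0 < l\<close> by simp
    next
      assume "i = D"
      then show ?thesis using that ear(3) bwd_eq[of l j] \<open>0 < l\<close> by simp
    qed
  qed
  have "odd D" using odd_ab unfolding D_def by simp
  show ?thesis
  proof (cases "odd l")
    case True
    have "D = 1 \<and> l = 1"
    proof (rule odd_paths_trivial[OF hp ear(1) fwd bwd])
      show "even (n - l)" using True n(2) l(1) by simp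
    qed (use ear(2,3) bwd_0 bwd_l \<open>odd D\<close> l(1) True in \<open>simp_all add: ear_fwd ear_bwd bwd_eq\<close>)
    then have "b = Suc a" "{t ! a, t ! b} = {s ! 0, s ! (Suc 0 mod length s)}"
      using ab(1,3) l(2) n(3) unfolding D_def n_def by auto
    moreover have "0 < length s" using n(3) unfolding n_def by linarith
    ultimately show ?thesis by blast
  next
    case False
    have bwd_fwd: "i \<le> n - l \<Longrightarrow> j \<le> l \<Longrightarrow> bwd i = s ! j \<Longrightarrow>
        i = 0 \<and> j = 0 \<or> i = n - l \<and> j = l" for i j
      using bwd_eq[of j i] by auto
    have "D = 1 \<and> n - l = 1"
    proof (rule odd_paths_trivial[OF hp ear(1) bwd fwd])
      show "odd (n - l)" using False n(2) l(1) by simp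
    qed (use ear(2,3) bwd_0 bwd_l \<open>odd D\<close> \<open>0 < l\<close> False in \<open>simp_all add: ear_fwd ear_bwd bwd_fwd\<close>)
    \<comment> \<open>Here the odd arc is the edge that closes the list, from index
      \<open>n - 1\<close> to index 0.\<close>
    then have "b = Suc a" "l = n - 1" using ab(1) l(1) unfolding D_def by auto
    moreover have "Suc (n - 1) = length s" using n(3) unfolding n_def by simp
    then have "Suc (n - 1) mod length s = 0" by simp
    ultimately have "{t ! a, t ! b} = {s ! (n - 1), s ! (Suc (n - 1) mod length s)}"
      using ab(3) l(2) by (simp add: insert_commute)
    moreover have "n - 1 < length s" using n(3) unfolding n_def by linarith
    ultimately show ?thesis using \<open>b = Suc a\<close> by blast
  qed
qed

lemma nth_rotate_Suc:
  assumes "i < length s"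
  shows "rotate m s ! (Suc i mod length s) = s ! (Suc ((m + i) mod length s) mod length s)"
proof -
  have "Suc i mod length s < length s" using assms by (intro mod_less_divisor) auto
  then have "rotate m s ! (Suc i mod length s) = s ! ((m + Suc i mod length s) mod length s)"
    by (rule nth_rotate)
  then show ?thesis by (simp add: mod_simps)
qed

lemma odd_circuit_rotate:
  assumes "odd_circuit H s"
  shows "odd_circuit H (rotate m s)"
proof -
  have "joined H (medges H) (rotate m s ! i) (rotate m s ! (Suc i mod length s))" if "i < length s" for i
  proof -
    have "rotate m s ! i = s ! ((m + i) mod length s)"
      "rotate m s ! (Suc i mod length s) = s ! (Suc ((m + i) mod length s) mod length s)"
      using that by (simp_all add: nth_rotate nth_rotate_Suc)
    moreover have "(m + i) mod length s < length s"
      using that by (intro mod_less_divisor) auto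
    ultimately show ?thesis using assms unfolding odd_circuit_def by simp
  qed
  then show ?thesis using assms unfolding odd_circuit_def by simp
qed

text \<open>Rotating the circuit moves the start of the ear to index 0; the circuit edge found there
  is carried back to the unrotated list.\<close>

lemma ear_free_if_h_perfect:
  assumes "h_perfect (line_graph H)"
  shows "ear_free H"
  unfolding ear_free_def
proof (intro allI impI)
  fix s t a b
  assume s: "odd_circuit H s"
    and t: "distinct t" "\<forall>i. Suc i < length t \<longrightarrow> joined H (medges H) (t ! i) (t ! Suc i)"
    and ab: "a < b" "b < length t" "t ! a \<in> set s" "t ! b \<in> set s"
    and inner: "\<forall>i. a < i \<longrightarrow> i < b \<longrightarrow> t ! i \<notin> set s"
    and odd: "odd (b - a)"
  obtain m where m: "m < length s" "t ! a = s ! m"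
    using ab(3) by (auto simp: in_set_conv_nth)
  have start: "t ! a = rotate m s ! 0"
  proof -
    have "0 < length s" using m by linarith
    then show ?thesis using m by (simp add: nth_rotate)
  qed
  have "b = Suc a \<and> (\<exists>i<length (rotate m s).
      {t ! a, t ! b} = {rotate m s ! i, rotate m s ! (Suc i mod length (rotate m s))})"
    using ab inner odd t
    by (intro ear_from_start[OF assms odd_circuit_rotate[OF s] _ _ _ _ start]) auto
  then obtain i where i: "b = Suc a" "i < length s"
      "{t ! a, t ! b} = {rotate m s ! i, rotate m s ! (Suc i mod length s)}"
    by auto
  have "rotate m s ! i = s ! ((m + i) mod length s)"
    "rotate m s ! (Suc i mod length s) = s ! (Suc ((m + i) mod length s) mod length s)"
    using i(2) by (simp_all add: nth_rotate nth_rotate_Suc)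
  moreover have "(m + i) mod length s < length s"
    using i(2) by (intro mod_less_divisor) auto
  ultimately show "b = Suc a \<and> (\<exists>i<length s. {t ! a, t ! b} = {s ! i, s ! (Suc i mod length s)})"
    using i by auto
qed

end

subsection \<open>Kempe changes\<close>

text \<open>The first edge belongs to \<open>B\<close>: the path will start at a vertex that \<open>A\<close> misses.\<close>

definition alternating :: "('v, 'e) multigraph \<Rightarrow> 'e set \<Rightarrow> 'e set \<Rightarrow> 'v list \<Rightarrow> bool" where
  "alternating H A B t \<longleftrightarrow> t \<noteq> [] \<and> distinct t \<and>
    (\<forall>i. Suc i < length t \<longrightarrow> joined H (if even i then B else A) (t ! i) (t ! Suc i))"

text \<open>A colouring listed by colour classes, so that an edge \<open>f\<close> can take
  \<open>c f\<close> colours at once.\<close>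

definition proper :: "('v, 'e) multigraph \<Rightarrow> nat \<Rightarrow> ('e \<Rightarrow> nat) \<Rightarrow> (nat \<Rightarrow> 'e set) \<Rightarrow> bool" where
  "proper H k c M \<longleftrightarrow> (\<forall>i<k. matching H (M i)) \<and>
    (\<forall>f\<in>medges H. card {i. i < k \<and> f \<in> M i} = c f)"

definition closed :: "('v, 'e) multigraph \<Rightarrow> 'e set \<Rightarrow> 'v set \<Rightarrow> bool" where
  "closed H A K \<longleftrightarrow> (\<forall>x\<in>K. \<forall>y. joined H A x y \<longrightarrow> y \<in> K)"

context multigraph
begin

text \<open>A longest alternating path from \<open>u\<close> is closed: an edge leading off it at
  the far end would lengthen it, inner vertices have their edges of both classes on it, and
  \<open>u\<close> misses \<open>A\<close>.\<close>

lemma alternating_closed: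
  assumes A: "matching H A" and B: "matching H B" and u: "\<And>y. \<not> joined H A u y"
  obtains t where "alternating H A B t" "t ! 0 = u" "closed H A (set t)" "closed H B (set t)"
proof -
  define P where "P t \<longleftrightarrow> alternating H A B t \<and> t ! 0 = u" for t
  have AB: "A \<subseteq> medges H" "B \<subseteq> medges H" using A B unfolding matching_def by auto
  have "P [u]" unfolding P_def alternating_def by simp
  \<comment> \<open>\<open>u\<close> is inserted because it need not be a vertex of
    \<open>H\<close>.\<close>
  have bound: "length t \<le> card (insert u (mverts H))" if "P t" for t
  proof -
    have "t ! i \<in> insert u (mverts H)" if "i < length t" for i
    proof (cases i)
      case (Suc j)
      then have "joined H (if even j then B else A) (t ! j) (t ! i)"
        using \<open>P t\<close> that unfolding P_def alternating_def by blast
      then have "joined H (medges H) (t ! j) (t ! i)"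
        using AB joined_mono by (metis (full_types))
      then show ?thesis using ends_subset unfolding joined_def by blast
    qed (use \<open>P t\<close> in \<open>simp add: P_def\<close>)
    then have "set t \<subseteq> insert u (mverts H)" by (metis in_set_conv_nth subsetI)
    then have "card (set t) \<le> card (insert u (mverts H))"
      using finite_mverts by (intro card_mono) auto
    then show ?thesis
      using \<open>P t\<close> distinct_card unfolding P_def alternating_def by metis
  qed
  have "\<exists>t. P t \<and> (\<forall>t'. P t' \<longrightarrow> length t' \<le> length t)"
    using \<open>P [u]\<close> bound
    by (intro ex_has_greatest_nat[of P "[u]" length "Suc (card (insert u (mverts H)))"])
      (auto simp: less_Suc_eq_le)
  then obtain t where t: "P t" and max: "\<And>t'. P t' \<Longrightarrow> length t' \<le> length t"
    by blast
  have alt: "alternating H A B t" "t ! 0 = u" using t unfolding P_def by auto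
  have step: "joined H (if even i then B else A) (t ! i) (t ! Suc i)" if "Suc i < length t" for i
    using alt that unfolding alternating_def by blast
  have matching: "matching H (if even i then B else A)" for i
    using A B by simp
  have next_in: "y \<in> set t" if i: "i < length t" and y: "joined H (if even i then B else A) (t ! i) y"
    for i y
  proof (cases "Suc i < length t")
    case True
    then have "y = t ! Suc i" using joined_unique[OF matching y step] by simp
    then show ?thesis using True by simp
  next
    case False
    then have len: "length t = Suc i" using i by simp
    show ?thesis
    proof (rule ccontr)
      assume "y \<notin> set t"
      moreover have "joined H (if even j then B else A) ((t @ [y]) ! j) ((t @ [y]) ! Suc j)"
        if "Suc j < length (t @ [y])" for j
        using that y step[of j] len by (cases "j = i") (auto simp: nth_append)
      ultimately have "P (t @ [y])"
        using alt unfolding P_def alternating_def by (auto simp: nth_append)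
      then show False using max by fastforce
    qed
  qed
  have prev_in: "y \<in> set t" if i: "i < length t" and y: "joined H (if even i then A else B) (t ! i) y"
    for i y
  proof (cases i)
    case 0
    then show ?thesis using y u alt by simp
  next
    case (Suc j)
    then have "joined H (if even j then B else A) (t ! i) (t ! j)"
      using joined_sym[OF step[of j]] i by simp
    moreover have "joined H (if even j then B else A) (t ! i) y"
      using y Suc by (simp split: if_splits)
    ultimately have "y = t ! j" using joined_unique[OF matching] by blast
    then show ?thesis using Suc i by simp
  qed
  have "closed H C (set t)" if C: "C = A \<or> C = B" for C
    unfolding closed_def
  proof (intro ballI allI impI)
    fix x y assume "x \<in> set t" and y: "joined H C x y"
    then obtain i where "i < length t" "x = t ! i" by (auto simp: in_set_conv_nth)
    then show "y \<in> set t"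
      using next_in[of i y] prev_in[of i y] C y by (cases "even i") auto
  qed
  then show thesis using that alt by blast
qed

lemma closed_ends:
  assumes "closed H A K" "A \<subseteq> medges H" "e \<in> A" "ends H e \<inter> K \<noteq> {}"
  shows "ends H e \<subseteq> K"
proof -
  obtain a b where e: "ends H e = {a, b}"
    using card_ends assms by (meson card_2_iff subsetD)
  then have "joined H A a b" "joined H A b a"
    using assms(3) unfolding joined_def by auto
  then show ?thesis using assms(1,4) e unfolding closed_def by auto
qed

lemma joined_cong:
  "(\<And>e. ends H e = {x, y} \<Longrightarrow> e \<in> S \<longleftrightarrow> e \<in> T) \<Longrightarrow> joined H S x y \<longleftrightarrow> joined H T x y"
  unfolding joined_def by blast

text \<open>Every edge of the two colours lies inside \<open>K\<close> or is disjoint from it, so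
  exchanging the colours inside \<open>K\<close> keeps both classes matchings. The effect is
  recorded vertex by vertex, the form in which free colours are inspected.\<close>

lemma swap:
  assumes M: "proper H k c M" and ab: "\<alpha> < k" "\<beta> < k" "\<alpha> \<noteq> \<beta>"
    and K: "closed H (M \<alpha>) K" "closed H (M \<beta>) K"
  obtains M' where "proper H k c M'"
    "\<And>i. i \<noteq> \<alpha> \<Longrightarrow> i \<noteq> \<beta> \<Longrightarrow> M' i = M i"
    "\<And>x y. x \<in> K \<Longrightarrow> joined H (M' \<alpha>) x y \<longleftrightarrow> joined H (M \<beta>) x y"
    "\<And>x y. x \<in> K \<Longrightarrow> joined H (M' \<beta>) x y \<longleftrightarrow> joined H (M \<alpha>) x y"
    "\<And>x y. x \<notin> K \<Longrightarrow> joined H (M' \<alpha>) x y \<longleftrightarrow> joined H (M \<alpha>) x y"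
    "\<And>x y. x \<notin> K \<Longrightarrow> joined H (M' \<beta>) x y \<longleftrightarrow> joined H (M \<beta>) x y"
proof -
  define \<tau> where "\<tau> = Transposition.transpose \<alpha> \<beta>"
  define M' where "M' i = {e \<in> M i. \<not> ends H e \<subseteq> K} \<union> {e \<in> M (\<tau> i). ends H e \<subseteq> K}" for i
  have \<tau>: "\<tau> \<alpha> = \<beta>" "\<tau> \<beta> = \<alpha>" "\<And>i. i \<noteq> \<alpha> \<Longrightarrow> i \<noteq> \<beta> \<Longrightarrow> \<tau> i = i" "bij \<tau>"
    "\<And>i. \<tau> i < k \<longleftrightarrow> i < k"
    using ab unfolding \<tau>_def by (auto simp: Transposition.transpose_def)
  have match: "matching H (M i)" if "i < k" for i
    using M that unfolding proper_def by blast
  have sub: "M \<alpha> \<subseteq> medges H" "M \<beta> \<subseteq> medges H"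
    using match ab unfolding matching_def by auto
  have disj: "ends H e \<inter> K = {}" if "e \<in> M \<alpha> \<or> e \<in> M \<beta>" "\<not> ends H e \<subseteq> K" for e
    using closed_ends[OF K(1) sub(1), of e] closed_ends[OF K(2) sub(2), of e] that by blast
  have other: "M' i = M i" if "i \<noteq> \<alpha>" "i \<noteq> \<beta>" for i
    using \<tau>(3)[OF that] unfolding M'_def by auto
  have mixed: "matching H ({e \<in> A. \<not> ends H e \<subseteq> K} \<union> {e \<in> B. ends H e \<subseteq> K})"
    if "matching H A" "matching H B" "\<And>e. e \<in> A \<Longrightarrow> \<not> ends H e \<subseteq> K \<Longrightarrow> ends H e \<inter> K = {}" for A B
    unfolding matching_def
  proof (intro conjI ballI impI)
    fix e f
    assume "e \<in> {e \<in> A. \<not> ends H e \<subseteq> K} \<union> {e \<in> B. ends H e \<subseteq> K}"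
      "f \<in> {e \<in> A. \<not> ends H e \<subseteq> K} \<union> {e \<in> B. ends H e \<subseteq> K}" "e \<noteq> f"
    then show "ends H e \<inter> ends H f = {}"
      using that(3)[of e] that(3)[of f] that(1,2) unfolding matching_def by blast
  qed (use that(1,2) in \<open>auto simp: matching_def\<close>)
  have "matching H (M' i)" if "i < k" for i
  proof (cases "i = \<alpha> \<or> i = \<beta>")
    case True
    then show ?thesis
      using mixed[of "M \<alpha>" "M \<beta>"] mixed[of "M \<beta>" "M \<alpha>"] match ab disj \<tau> unfolding M'_def by auto
  next
    case False
    then show ?thesis using other match that by simp
  qed
  moreover have "card {i. i < k \<and> f \<in> M' i} = card {i. i < k \<and> f \<in> M i}" for f
  proof (cases "ends H f \<subseteq> K")
    case True
    \<comment> \<open>An edge inside \<open>K\<close> has its set of colours permuted, so their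
      number is unchanged.\<close>
    then have "{i. i < k \<and> f \<in> M' i} = \<tau> -` {i. i < k \<and> f \<in> M i}"
      using \<tau>(5) unfolding M'_def by auto
    moreover have "card (\<tau> -` {i. i < k \<and> f \<in> M i}) = card {i. i < k \<and> f \<in> M i}"
      using \<tau>(4) by (intro card_vimage_inj) (auto simp: bij_def)
    ultimately show ?thesis by simp
  next
    case False
    then show ?thesis unfolding M'_def by simp
  qed
  ultimately have "proper H k c M'"
    using M unfolding proper_def by simp
  moreover have mem: "M' \<alpha> = {e \<in> M \<alpha>. \<not> ends H e \<subseteq> K} \<union> {e \<in> M \<beta>. ends H e \<subseteq> K}"
    "M' \<beta> = {e \<in> M \<beta>. \<not> ends H e \<subseteq> K} \<union> {e \<in> M \<alpha>. ends H e \<subseteq> K}"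
    unfolding M'_def \<tau> by auto
  have in_K: "ends H e \<subseteq> K \<longleftrightarrow> x \<in> K" if "e \<in> M \<alpha> \<union> M \<beta>" "ends H e = {x, y}" for e x y
    using disj[of e] that by auto
  have swapped: "joined H ({e \<in> A. \<not> ends H e \<subseteq> K} \<union> {e \<in> B. ends H e \<subseteq> K}) x y \<longleftrightarrow>
      joined H (if x \<in> K then B else A) x y" if "A \<union> B \<subseteq> M \<alpha> \<union> M \<beta>" for A B x y
  proof -
    have "e \<in> {e \<in> A. \<not> ends H e \<subseteq> K} \<union> {e \<in> B. ends H e \<subseteq> K} \<longleftrightarrow>
        e \<in> (if x \<in> K then B else A)" if "ends H e = {x, y}" for e
    proof (cases "e \<in> A \<union> B")
      case True
      then have "ends H e \<subseteq> K \<longleftrightarrow> x \<in> K"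
        using \<open>A \<union> B \<subseteq> M \<alpha> \<union> M \<beta>\<close> that by (intro in_K[of e x y]) auto
      then show ?thesis by simp
    qed auto
    then show ?thesis by (rule joined_cong)
  qed
  have "joined H (M' \<alpha>) x y \<longleftrightarrow> joined H (if x \<in> K then M \<beta> else M \<alpha>) x y"
    "joined H (M' \<beta>) x y \<longleftrightarrow> joined H (if x \<in> K then M \<alpha> else M \<beta>) x y" for x y
    using swapped[of "M \<alpha>" "M \<beta>" x y] swapped[of "M \<beta>" "M \<alpha>" x y] unfolding mem by simp_all
  ultimately show thesis using that[of M'] other by simp
qed

end

section \<open>Colour classes on the odd Kempe circuit\<close>

text \<open>Expresses that no further edge between \<open>u\<close> and \<open>v\<close> can be
  coloured. Ranging over all proper families makes this survive every Kempe change.\<close>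

definition stuck :: "('v, 'e) multigraph \<Rightarrow> nat \<Rightarrow> ('e \<Rightarrow> nat) \<Rightarrow> 'v \<Rightarrow> 'v \<Rightarrow> bool" where
  "stuck H k c u v \<longleftrightarrow> (\<forall>M i. proper H k c M \<longrightarrow> i < k \<longrightarrow>
    (\<exists>y. joined H (M i) u y) \<or> (\<exists>y. joined H (M i) v y))"

context multigraph
begin

lemma ear_freeD:
  assumes "ear_free H" "odd_circuit H s" "distinct t"
    and "\<And>i. Suc i < length t \<Longrightarrow> joined H (medges H) (t ! i) (t ! Suc i)"
    and "a < b" "b < length t" "t ! a \<in> set s" "t ! b \<in> set s"
    and "\<And>i. a < i \<Longrightarrow> i < b \<Longrightarrow> t ! i \<notin> set s" "odd (b - a)"
  shows "b = Suc a" "\<exists>i<length s. {t ! a, t ! b} = {s ! i, s ! (Suc i mod length s)}"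
  using assms unfolding ear_free_def by blast+

lemma alternating_joined:
  assumes "alternating H A B t" "A \<subseteq> medges H" "B \<subseteq> medges H" "Suc i < length t"
  shows "joined H (medges H) (t ! i) (t ! Suc i)"
  using assms joined_mono unfolding alternating_def by (metis (full_types))

lemma even_matched_within:
  assumes "\<And>i. even i \<Longrightarrow> Suc i < length s \<Longrightarrow> joined H B (s ! i) (s ! Suc i)"
    and "x \<in> set s" "x \<noteq> s ! (length s - 1)"
  obtains z where "z \<in> set s" "joined H B x z"
proof -
  obtain m where m: "m < length s" "x = s ! m" using assms(2) by (auto simp: in_set_conv_nth)
  show thesis
  proof (cases "even m")
    case True
    have "m \<noteq> length s - 1" using m assms(3) by auto
    then have "Suc m < length s" using m by simp
    then show thesis using that[of "s ! Suc m"] assms(1)[OF True] m by simp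
  next
    case False
    then obtain j where "m = Suc j" "even j" by (cases m) auto
    then show thesis using that[of "s ! j"] joined_sym[OF assms(1)[of j]] m by simp
  qed
qed

lemma odd_matched_within:
  assumes "odd (length s)"
    and "\<And>i. odd i \<Longrightarrow> Suc i < length s \<Longrightarrow> joined H A (s ! i) (s ! Suc i)"
    and "x \<in> set s" "x \<noteq> s ! 0"
  obtains z where "z \<in> set s" "joined H A x z"
proof -
  obtain m where m: "m < length s" "x = s ! m" using assms(3) by (auto simp: in_set_conv_nth)
  then obtain j where j: "m = Suc j" using assms(4) by (cases m) auto
  show thesis
  proof (cases "even m")
    case False
    \<comment> \<open>The last index is even, so a vertex at an odd index has a successor.\<close>
    then have "Suc m \<noteq> length s" using assms(1) by (metis even_Suc)
    then have "Suc m < length s" using m by simp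
    then show thesis using that[of "s ! Suc m"] assms(2)[OF False] m by simp
  next
    case True
    then show thesis using that[of "s ! j"] joined_sym[OF assms(2)[of j]] m j by simp
  qed
qed

text \<open>Every ear cut out by \<open>t\<close> starts and ends with edges of \<open>G\<close>, hence is odd.\<close>

lemma alternating_eq_circuit:
  assumes ef: "ear_free H" and s: "odd_circuit H s"
    and G: "matching H G" and B: "matching H B"
    and sB: "\<And>i. even i \<Longrightarrow> Suc i < length s \<Longrightarrow> joined H B (s ! i) (s ! Suc i)"
    and last: "\<And>y. \<not> joined H B (s ! (length s - 1)) y"
    and t: "alternating H G B t" "t ! 0 = s ! 0" "t ! (length t - 1) = s ! (length s - 1)"
  shows "t = s"
proof -
  have GB: "G \<subseteq> medges H" "B \<subseteq> medges H" using G B unfolding matching_def by auto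
  have s': "distinct s" "odd (length s)" "3 \<le> length s" using s unfolding odd_circuit_def by auto
  have t': "distinct t" "t \<noteq> []" using t unfolding alternating_def by auto
  have step: "joined H (if even i then B else G) (t ! i) (t ! Suc i)" if "Suc i < length t" for i
    using t that unfolding alternating_def by blast
  have t_eq: "i = j" if "t ! i = t ! j" "i < length t" "j < length t" for i j
    using that t'(1) by (simp add: nth_eq_iff_index_eq)
  \<comment> \<open>Walking along \<open>t\<close>, an edge of \<open>B\<close> is forced by
    uniqueness of partners and an edge of \<open>G\<close> by the absence of long odd ears.\<close>
  have eq: "i < length s \<and> t ! i = s ! i" if "i < length t" for i
    using that
  proof (induction i rule: less_induct)
    case (less i)
    show ?case
    proof (cases i)
      case 0
      moreover have "0 < length s" using s'(3) by linarith
      ultimately show ?thesis using t(2) by simp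
    next
      case (Suc j)
      have j: "Suc j < length t" "t ! j = s ! j" "j < length s"
        using less Suc by auto
      \<comment> \<open>The last vertex of \<open>s\<close> occurs in \<open>t\<close> only at the
        very end.\<close>
      have "j \<noteq> length s - 1"
        using t_eq[of j "length t - 1"] t(3) j by auto
      then have Suc_j: "Suc j < length s" using j by simp
      show ?thesis
      proof (cases "even j")
        case True
        then have "joined H B (s ! j) (t ! Suc j)" using step[OF j(1)] j by simp
        then have "t ! Suc j = s ! Suc j"
          using joined_unique[OF B _ sB[OF True Suc_j]] by blast
        then show ?thesis using Suc Suc_j by simp
      next
        case False
        \<comment> \<open>The least index satisfying \<open>Q\<close> is where \<open>t\<close> is
          next back on the circuit.\<close>
        define Q where "Q b \<longleftrightarrow> j < b \<and> b < length t \<and> t ! b \<in> set s" for b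
        have "Q (length t - 1)"
          using j t(3) s' unfolding Q_def by (auto intro!: nth_mem)
        define b where "b = (LEAST b. Q b)"
        have "Q b"
          using \<open>Q (length t - 1)\<close> unfolding b_def by (rule LeastI)
        then have b: "j < b" "b < length t" "t ! b \<in> set s"
          unfolding Q_def by auto
        have "\<not> Q i" if "i < b" for i
          using that not_less_Least unfolding b_def by blast
        then have inner: "t ! i \<notin> set s" if "j < i" "i < b" for i
          using that b unfolding Q_def by auto
        \<comment> \<open>At an odd index \<open>t\<close> would come back along an edge of
          \<open>B\<close>; but every vertex of the circuit except the last has its
          \<open>B\<close>-partner on the circuit, and the last one has none.\<close>
        have "even b"
        proof (rule ccontr)
          assume "odd b"
          then obtain b' where b': "b = Suc b'" "even b'" by (cases b) auto
          then have "b' \<noteq> j" using False by auto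
          then have "t ! b' \<notin> set s" using inner b b' by simp
          moreover have joined: "joined H B (t ! b) (t ! b')"
            using joined_sym step[of b'] b b' by auto
          then have "t ! b \<noteq> s ! (length s - 1)" using last by auto
          then obtain z where "z \<in> set s" "joined H B (t ! b) z"
            using even_matched_within[OF sB b(3)] by blast
          ultimately show False using joined_unique[OF B joined] by blast
        qed
        then have "odd (b - j)" using False b by simp
        then have ear: "b = Suc j" "\<exists>i<length s. {t ! j, t ! b} = {s ! i, s ! (Suc i mod length s)}"
          using ear_freeD[OF ef s t'(1) alternating_joined[OF t(1) GB] b(1,2) _ b(3) inner] j
          by (auto intro: nth_mem)
        then obtain i where i: "i < length s" "{t ! j, t ! Suc j} = {s ! i, s ! (Suc i mod length s)}"
          by auto
        \<comment> \<open>The edge of \<open>t\<close> is parallel to a circuit edge at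
          \<open>s ! j\<close>; the one towards \<open>s ! (j - 1)\<close> is excluded because
          \<open>t\<close> has already been there.\<close>
        have neq: "t ! Suc j \<noteq> t ! (j - 1)"
          using t_eq[of "Suc j" "j - 1"] j(1) by linarith
        have "0 < j" using False by (auto intro: Nat.gr0I)
        have prev: "t ! (j - 1) = s ! (j - 1)"
          using less.IH[of "j - 1"] j Suc by simp
        have cases: "s ! j = s ! i \<and> t ! Suc j = s ! (Suc i mod length s) \<or>
            s ! j = s ! (Suc i mod length s) \<and> t ! Suc j = s ! i"
          using i(2) j(2) by (metis doubleton_eq_iff)
        have case1: "i = j" if "s ! j = s ! i"
          using that i j s'(1) by (simp add: nth_eq_iff_index_eq)
        have case2: "i = j - 1" if "s ! j = s ! (Suc i mod length s)"
        proof -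
          have "Suc i mod length s < length s" using i by (intro mod_less_divisor) auto
          then have "j = Suc i mod length s"
            using that j s'(1) by (simp add: nth_eq_iff_index_eq)
          then show ?thesis using \<open>0 < j\<close> i(1) by (auto simp: mod_Suc split: if_splits)
        qed
        have "t ! Suc j = s ! Suc j"
          using cases
        proof
          assume "s ! j = s ! i \<and> t ! Suc j = s ! (Suc i mod length s)"
          then show ?thesis using case1 Suc_j by simp
        next
          assume "s ! j = s ! (Suc i mod length s) \<and> t ! Suc j = s ! i"
          then show ?thesis using case2 prev neq by metis
        qed
        then show ?thesis using Suc Suc_j by simp
      qed
    qed
  qed
  have "0 < length t" "0 < length s" using t'(2) s'(3) by auto
  then have "length t - 1 = length s - 1"
    using eq[of "length t - 1"] t(3) nth_eq_iff_index_eq[OF s'(1), of "length t - 1" "length s - 1"]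
    by simp
  then have "length t = length s" using t'(2) s'(3) by (cases t) auto
  then show "t = s" using eq by (intro nth_equalityI) auto
qed

text \<open>Once the path \<open>t\<close> leaves the circuit it never returns, as it would close an odd ear.\<close>

lemma alternating_leaves_once:
  assumes ef: "ear_free H" and s: "odd_circuit H s"
    and A: "matching H A" and G: "matching H G"
    and sA: "\<And>i. odd i \<Longrightarrow> Suc i < length s \<Longrightarrow> joined H A (s ! i) (s ! Suc i)"
    and t: "alternating H A G t" "t ! 0 = s ! 0"
  shows "\<exists>r. \<forall>x\<in>set t \<inter> set s. x \<noteq> r \<longrightarrow> (\<exists>y\<in>set s. joined H G x y)"
proof -
  have AG: "A \<subseteq> medges H" "G \<subseteq> medges H" using A G unfolding matching_def by auto
  have s': "distinct s" "odd (length s)" "3 \<le> length s" using s unfolding odd_circuit_def by auto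
  have t': "distinct t" "t \<noteq> []" using t unfolding alternating_def by auto
  have step: "joined H (if even i then G else A) (t ! i) (t ! Suc i)" if "Suc i < length t" for i
    using t that unfolding alternating_def by blast
  have t0: "t ! 0 \<in> set s" unfolding t(2) using s' by (intro nth_mem) auto
  \<comment> \<open>Every vertex of the circuit except \<open>s ! 0\<close> has its
    \<open>A\<close>-partner on the circuit.\<close>
  have A_in: "y \<in> set s" if i: "i < length t" "0 < i" "t ! i \<in> set s" and y: "joined H A (t ! i) y" for i y
  proof -
    have "t ! i \<noteq> s ! 0"
      using nth_eq_iff_index_eq[OF t'(1) i(1), of 0] i t'(2) unfolding t(2)[symmetric] by simp
    then obtain z where "z \<in> set s" "joined H A (t ! i) z"
      using odd_matched_within[OF s'(2) sA i(3)] by blast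
    then show ?thesis using joined_unique[OF A y] by blast
  qed
  have no_return: "t ! i \<in> set s" if "i \<le> p" "p < length t" "t ! p \<in> set s" for i p
  proof (rule ccontr)
    assume "t ! i \<notin> set s"
    define c where "c = (LEAST i. t ! i \<notin> set s)"
    have c: "t ! c \<notin> set s" "c \<le> i"
      using \<open>t ! i \<notin> set s\<close> unfolding c_def by (rule LeastI, rule Least_le)
    have below_c: "t ! j \<in> set s" if "j < c" for j
      using that not_less_Least unfolding c_def by blast
    have "c \<noteq> 0" using c(1) t0 by metis
    then obtain a where a: "c = Suc a" by (cases c) auto
    have a_in: "t ! a \<in> set s" using below_c a by simp
    define Q where "Q b \<longleftrightarrow> c < b \<and> b < length t \<and> t ! b \<in> set s" for b
    have "c \<noteq> p" using c(1) that(3) by metis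
    then have "Q p" using that c(2) unfolding Q_def by simp
    define b where "b = (LEAST b. Q b)"
    have "Q b"
      using \<open>Q p\<close> unfolding b_def by (rule LeastI)
    then have b: "c < b" "b < length t" "t ! b \<in> set s"
      unfolding Q_def by auto
    have "\<not> Q j" if "j < b" for j
      using that not_less_Least unfolding b_def by blast
    then have inner: "t ! j \<notin> set s" if "a < j" "j < b" for j
      using that b c(1) a unfolding Q_def by (cases "j = c") auto
    \<comment> \<open>Edges of \<open>A\<close> neither leave nor re-enter the circuit, so the ear
      from \<open>a\<close> to \<open>b\<close> begins and ends with edges of \<open>G\<close> and
      is odd.\<close>
    have "even a"
    proof (rule ccontr)
      assume "odd a"
      then have "joined H A (t ! a) (t ! c)" using step[of a] a b by simp
      moreover have "0 < a" using \<open>odd a\<close> by (auto intro: Nat.gr0I)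
      ultimately show False using A_in[of a] a_in c(1) a b by simp
    qed
    moreover have "odd b"
    proof (rule ccontr)
      assume "\<not> odd b"
      moreover have "b \<noteq> 0" using b by simp
      ultimately obtain b' where b': "b = Suc b'" "odd b'" by (cases b) auto
      then have "joined H A (t ! b) (t ! b')" using joined_sym step[of b'] b by auto
      then have "t ! b' \<in> set s" using A_in[of b] b by simp
      then show False using inner[of b'] b b' a by simp
    qed
    ultimately have "odd (b - a)" using a b by simp
    \<comment> \<open>The odd ear would be a single edge, yet \<open>c\<close> lies strictly between
      its ends.\<close>
    then have "b = Suc a"
      using ear_freeD[OF ef s t'(1) alternating_joined[OF t(1) AG] _ b(2) a_in b(3) inner] a b(1)
      by simp
    then show False using a b by simp
  qed
  \<comment> \<open>The exceptional vertex is the last one of \<open>t\<close> on the circuit: all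
    earlier vertices of \<open>t\<close> lie on the circuit, and so do their
    \<open>G\<close>-partners.\<close>
  define p where "p = Max {i. i < length t \<and> t ! i \<in> set s}"
  have "{i. i < length t \<and> t ! i \<in> set s} \<noteq> {}" using t0 t' by auto
  then have p: "p < length t" "t ! p \<in> set s" "\<And>i. i < length t \<Longrightarrow> t ! i \<in> set s \<Longrightarrow> i \<le> p"
    using Max_in[of "{i. i < length t \<and> t ! i \<in> set s}"] unfolding p_def by auto
  have "\<exists>y\<in>set s. joined H G x y" if x: "x \<in> set t \<inter> set s" "x \<noteq> t ! p" for x
  proof -
    obtain i where i: "i < length t" "x = t ! i" using x by (auto simp: in_set_conv_nth)
    then have "i < p" using p(3)[of i] x by (cases "i = p") auto
    show ?thesis
    proof (cases "even i")
      case True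
      then show ?thesis
        using step[of i] no_return[of "Suc i" p] p \<open>i < p\<close> i by auto
    next
      case False
      then obtain j where j: "i = Suc j" "even j" by (cases i) auto
      then have "joined H G x (t ! j)" using joined_sym step[of j] i by auto
      then show ?thesis using no_return[of j p] p j \<open>i < p\<close> by auto
    qed
  qed
  then show ?thesis by blast
qed

text \<open>If the path from \<open>u\<close> avoided \<open>v\<close>, exchanging its colours would
  make \<beta> free at both \<open>u\<close> and \<open>v\<close>. Since \<open>v\<close> misses
  \<beta>, the path can arrive there only by \<alpha> and has to stop.\<close>

lemma kempe_path:
  assumes M: "proper H k c M" and stuck: "stuck H k c u v"
    and ab: "\<alpha> < k" "\<beta> < k" "\<alpha> \<noteq> \<beta>"
    and u: "\<And>y. \<not> joined H (M \<alpha>) u y" and v: "\<And>y. \<not> joined H (M \<beta>) v y"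
  obtains t where "alternating H (M \<alpha>) (M \<beta>) t" "t ! 0 = u" "t ! (length t - 1) = v" "odd (length t)"
proof -
  have match: "matching H (M \<alpha>)" "matching H (M \<beta>)" using M ab unfolding proper_def by auto
  obtain t where t: "alternating H (M \<alpha>) (M \<beta>) t" "t ! 0 = u"
      and closed: "closed H (M \<alpha>) (set t)" "closed H (M \<beta>) (set t)"
    using alternating_closed[OF match u] by blast
  have t': "t \<noteq> []" using t unfolding alternating_def by auto
  have step: "joined H (if even i then M \<beta> else M \<alpha>) (t ! i) (t ! Suc i)" if "Suc i < length t" for i
    using t that unfolding alternating_def by blast
  have "v \<in> set t"
  proof (rule ccontr)
    assume "v \<notin> set t"
    obtain M' where M': "proper H k c M'"
      "\<And>x y. x \<in> set t \<Longrightarrow> joined H (M' \<beta>) x y \<longleftrightarrow> joined H (M \<alpha>) x y"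
      "\<And>x y. x \<notin> set t \<Longrightarrow> joined H (M' \<beta>) x y \<longleftrightarrow> joined H (M \<beta>) x y"
      using swap[OF M ab closed] by metis
    have "u \<in> set t" using t(2) t' by (metis length_greater_0_conv nth_mem)
    then show False
      using stuck M'(1) ab(2) M'(2,3) \<open>v \<notin> set t\<close> u v unfolding stuck_def by metis
  qed
  then obtain q where q: "q < length t" "v = t ! q" by (auto simp: in_set_conv_nth)
  have "even q"
  proof (rule ccontr)
    assume "odd q"
    then obtain j where "q = Suc j" "even j" by (cases q) auto
    then show False using step[of j] joined_sym q v by fastforce
  qed
  moreover have "Suc q = length t"
  proof (rule ccontr)
    assume "Suc q \<noteq> length t"
    then show False using step[of q] \<open>even q\<close> q v by auto
  qed
  ultimately show thesis using that[OF t] q by (metis diff_Suc_1 even_Suc)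
qed

text \<open>A third colour \<gamma> is treated along the \<alpha>-\<gamma> path \<open>t\<close>
  from \<open>u\<close>. On \<open>t\<close>, the path itself supplies the \<gamma>-partners, with
  one exception. Off \<open>t\<close>, exchanging the colours along \<open>t\<close> changes
  nothing, and after the exchange \<gamma> occupies the odd positions of the circuit.\<close>

lemma kempe_colour:
  assumes ef: "ear_free H" and M: "proper H k c M" and stuck: "stuck H k c u v"
    and ab: "\<alpha> < k" "\<beta> < k" "\<alpha> \<noteq> \<beta>"
    and u: "\<And>y. \<not> joined H (M \<alpha>) u y" and v: "\<And>y. \<not> joined H (M \<beta>) v y"
    and s: "odd_circuit H s" "alternating H (M \<alpha>) (M \<beta>) s" "s ! 0 = u" "s ! (length s - 1) = v"
    and "\<gamma> < k"
  shows "\<exists>r. \<forall>x\<in>set s. x \<noteq> r \<longrightarrow> (\<exists>y\<in>set s. joined H (M \<gamma>) x y)"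
proof -
  have match: "matching H (M i)" if "i < k" for i using M that unfolding proper_def by auto
  have s': "odd (length s)" using s unfolding odd_circuit_def by auto
  have sA: "joined H (M \<alpha>) (s ! i) (s ! Suc i)" if "odd i" "Suc i < length s" for i
    using s(2) that unfolding alternating_def by (metis (full_types))
  have sB: "joined H (M \<beta>) (s ! i) (s ! Suc i)" if "even i" "Suc i < length s" for i
    using s(2) that unfolding alternating_def by (metis (full_types))
  show ?thesis
  proof (cases "\<gamma> = \<alpha> \<or> \<gamma> = \<beta>")
    case True
    \<comment> \<open>The exception is \<open>u\<close> for \<alpha> and \<open>v\<close> for
      \<beta>.\<close>
    then show ?thesis
      using odd_matched_within[OF s' sA] even_matched_within[OF sB]
      by metis
  next
    case False
    obtain t where t: "alternating H (M \<alpha>) (M \<gamma>) t" "t ! 0 = u"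
      and closed: "closed H (M \<alpha>) (set t)" "closed H (M \<gamma>) (set t)"
      using alternating_closed[OF match[OF ab(1)] match[OF \<open>\<gamma> < k\<close>] u] by blast
    have "t \<noteq> []" using t unfolding alternating_def by auto
    then have u_t: "u \<in> set t" using t(2) by (metis length_greater_0_conv nth_mem)
    obtain r where r: "\<And>x. x \<in> set t \<inter> set s \<Longrightarrow> x \<noteq> r \<Longrightarrow> \<exists>y\<in>set s. joined H (M \<gamma>) x y"
      using alternating_leaves_once[OF ef s(1) match[OF ab(1)] match[OF \<open>\<gamma> < k\<close>] sA t(1)] t(2) s(3)
      by metis
    have "\<alpha> \<noteq> \<gamma>" using False by simp
    obtain M' where M': "proper H k c M'" "M' \<beta> = M \<beta>"
      "\<And>x y. x \<in> set t \<Longrightarrow> joined H (M' \<gamma>) x y \<longleftrightarrow> joined H (M \<alpha>) x y"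
      "\<And>x y. x \<notin> set t \<Longrightarrow> joined H (M' \<gamma>) x y \<longleftrightarrow> joined H (M \<gamma>) x y"
      using swap[OF M ab(1) \<open>\<gamma> < k\<close> \<open>\<alpha> \<noteq> \<gamma>\<close> closed] False ab(3) by metis
    have match': "matching H (M' \<gamma>)" using M'(1) \<open>\<gamma> < k\<close> unfolding proper_def by auto
    have u': "\<not> joined H (M' \<gamma>) u y" for y using M'(3)[OF u_t] u by simp
    have v': "\<not> joined H (M' \<beta>) v y" for y using M'(2) v by simp
    have "\<gamma> \<noteq> \<beta>" using False by simp
    obtain t' where t': "alternating H (M' \<gamma>) (M' \<beta>) t'" "t' ! 0 = u" "t' ! (length t' - 1) = v"
      using kempe_path[OF M'(1) stuck \<open>\<gamma> < k\<close> ab(2) \<open>\<gamma> \<noteq> \<beta>\<close> u' v'] by metis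
    \<comment> \<open>\<open>s\<close> is an odd circuit of \<open>H\<close> whatever the colours
      are, and its \<beta>-edges are untouched; so the new Kempe path is forced onto it.\<close>
    have "t' = s"
      using alternating_eq_circuit[OF ef s(1) match' match[OF ab(2)] sB] t' s(3,4) v M'(2) by metis
    then have sG: "joined H (M' \<gamma>) (s ! i) (s ! Suc i)" if "odd i" "Suc i < length s" for i
      using t'(1) that unfolding alternating_def by (metis (full_types))
    have "\<exists>y\<in>set s. joined H (M \<gamma>) x y" if x_s: "x \<in> set s" "x \<noteq> r" for x
    proof (cases "x \<in> set t")
      case True
      then show ?thesis using r x_s by blast
    next
      case x: False
      then have "x \<noteq> s ! 0" using u_t s(3) by auto
      then obtain z where "z \<in> set s" "joined H (M' \<gamma>) x z"
        using odd_matched_within[OF s' sG x_s(1)] by blast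
      then show ?thesis using M'(4)[OF x] by blast
    qed
    then show ?thesis by blast
  qed
qed

subsection \<open>Colouring with the round-up of the fractional optimum\<close>

lemma proper_sum:
  assumes "proper H k c M" "F \<subseteq> medges H"
  shows "(\<Sum>f\<in>F. c f) = (\<Sum>i<k. card (M i \<inter> F))"
proof -
  have "finite F" using assms(2) finite_medges finite_subset by blast
  moreover have "\<forall>f\<in>F. card {i \<in> {..<k}. f \<in> M i} = c f"
    using assms unfolding proper_def by auto
  ultimately have "(\<Sum>i<k. card {f \<in> F. f \<in> M i}) = (\<Sum>f\<in>F. c f)"
    by (intro sum_multicount_gen) auto
  moreover have "{f \<in> F. f \<in> M i} = M i \<inter> F" for i by auto
  ultimately show ?thesis by simp
qed

lemma proper_insert:
  assumes M: "proper H k (c(e := c e - 1)) M" and e: "e \<in> medges H" "ends H e = {u, v}" "0 < c e"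
    and i: "i < k" "\<And>y. \<not> joined H (M i) u y" "\<And>y. \<not> joined H (M i) v y"
  shows "proper H k c (M(i := insert e (M i)))"
proof -
  have match: "matching H (M j)" if "j < k" for j
    using M that unfolding proper_def by blast
  have sub: "M i \<subseteq> medges H" using match[OF i(1)] unfolding matching_def by blast
  have avoid: "u \<notin> ends H f" "v \<notin> ends H f" if "f \<in> M i" for f
    using joined_iff_incident[OF sub, of u] joined_iff_incident[OF sub, of v] i(2,3) that by auto
  then have "e \<notin> M i" using e(2) by blast
  have "ends H e \<inter> ends H f = {}" "ends H f \<inter> ends H e = {}" if "f \<in> M i" for f
    using avoid[OF that] e(2) by auto
  then have "matching H (insert e (M i))"
    using match[OF i(1)] e(1) unfolding matching_def by simp
  moreover have "card {j. j < k \<and> f \<in> (M(i := insert e (M i))) j} = c f" if f: "f \<in> medges H" for f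
  proof (cases "f = e")
    case True
    then have "{j. j < k \<and> f \<in> (M(i := insert e (M i))) j} = insert i {j. j < k \<and> f \<in> M j}"
      using i(1) by auto
    moreover have "card {j. j < k \<and> f \<in> M j} = c e - 1"
      using M f True unfolding proper_def by auto
    ultimately show ?thesis
      using True \<open>e \<notin> M i\<close> \<open>0 < c e\<close> by simp
  next
    case False
    then have "{j. j < k \<and> f \<in> (M(i := insert e (M i))) j} = {j. j < k \<and> f \<in> M j}"
      by auto
    then show ?thesis
      using M f False unfolding proper_def by simp
  qed
  ultimately show ?thesis using match unfolding proper_def by simp
qed

text \<open>Induction on the total weight: one copy of an edge is set aside and the rest is
  coloured; if the last copy is stuck, some odd vertex set violates its bound.\<close>

theorem proper_exists:
  assumes ef: "ear_free H"
    and deg: "\<And>x. (\<Sum>f | f \<in> medges H \<and> x \<in> ends H f. c f) \<le> k"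
    and within: "\<And>U. finite U \<Longrightarrow> odd (card U) \<Longrightarrow>
      2 * (\<Sum>f | f \<in> medges H \<and> ends H f \<subseteq> U. c f) \<le> k * (card U - 1)"
  shows "\<exists>M. proper H k c M"
  using deg within
proof (induction "\<Sum>f\<in>medges H. c f" arbitrary: c rule: less_induct)
  case (less c)
  show ?case
  proof (cases "\<exists>e\<in>medges H. 0 < c e")
    case False
    then have "proper H k c (\<lambda>_. {})" unfolding proper_def matching_def by simp
    then show ?thesis by blast
  next
    case True
    then obtain e where e: "e \<in> medges H" "0 < c e" by blast
    obtain u v where uv: "ends H e = {u, v}" "u \<noteq> v"
      using card_ends[OF e(1)] by (meson card_2_iff)
    define c' where "c' = c(e := c e - 1)"
    have c'_le: "c' f \<le> c f" for f unfolding c'_def by simp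
    have c'_less: "(\<Sum>f\<in>F. c' f) < (\<Sum>f\<in>F. c f)" if "e \<in> F" "F \<subseteq> medges H" for F
    proof (rule sum_strict_mono_ex1)
      show "finite F" using that finite_medges finite_subset by blast
      show "\<exists>f\<in>F. c' f < c f" using that e by (intro bexI[of _ e]) (auto simp: c'_def)
    qed (use c'_le in auto)
    have "\<exists>M. proper H k c' M"
    proof (rule less.hyps)
      show "(\<Sum>f\<in>medges H. c' f) < (\<Sum>f\<in>medges H. c f)" using c'_less e by blast
      show "(\<Sum>f | f \<in> medges H \<and> x \<in> ends H f. c' f) \<le> k" for x
        using less.prems(1)[of x] sum_mono[of _ c' c] c'_le le_trans by meson
      show "2 * (\<Sum>f | f \<in> medges H \<and> ends H f \<subseteq> U. c' f) \<le> k * (card U - 1)"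
        if "finite U" "odd (card U)" for U
        using less.prems(2)[OF that] sum_mono[of "{f \<in> medges H. ends H f \<subseteq> U}" c' c] c'_le
        by fastforce
    qed
    then obtain M where M: "proper H k c' M" by blast
    have match: "matching H (M i)" if "i < k" for i
      using M that unfolding proper_def by blast
    show ?thesis
    proof (rule ccontr)
      assume none: "\<nexists>M. proper H k c M"
      have stuck: "stuck H k c' u v"
        using proper_insert[of k c e _ u v, OF _ e(1) uv(1) e(2)] none
        unfolding stuck_def c'_def by blast
      \<comment> \<open>At an end of \<open>e\<close> fewer than \<open>k\<close> copies are
        coloured, so some colour is absent.\<close>
      have missing: "\<exists>i<k. \<forall>y. \<not> joined H (M i) x y" if "x \<in> ends H e" for x
      proof (rule ccontr)
        assume neg: "\<not> (\<exists>i<k. \<forall>y. \<not> joined H (M i) x y)"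
        define F where "F = {f \<in> medges H. x \<in> ends H f}"
        have F: "F \<subseteq> medges H" "e \<in> F" unfolding F_def using that e by auto
        have "1 \<le> card (M i \<inter> F)" if "i < k" for i
        proof -
          have sub: "M i \<subseteq> medges H" using match[OF \<open>i < k\<close>] unfolding matching_def by blast
          then obtain f where "f \<in> M i" "x \<in> ends H f"
            using neg \<open>i < k\<close> joined_iff_incident[OF sub, of x] by blast
          then have "f \<in> M i \<inter> F" using sub unfolding F_def by blast
          moreover have "finite (M i \<inter> F)" using finite_matching[OF match[OF \<open>i < k\<close>]] by blast
          ultimately show ?thesis by (metis One_nat_def Suc_leI card_gt_0_iff empty_iff)
        qed
        then have "(\<Sum>i<k. 1) \<le> (\<Sum>i<k. card (M i \<inter> F))" by (intro sum_mono) auto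
        then have "k \<le> (\<Sum>f\<in>F. c' f)" using proper_sum[OF M F(1)] by simp
        then show False using c'_less[OF F(2,1)] less.prems(1)[of x] unfolding F_def by simp
      qed
      obtain \<alpha> where \<alpha>: "\<alpha> < k" "\<And>y. \<not> joined H (M \<alpha>) u y" using missing[of u] uv by auto
      obtain \<beta> where \<beta>: "\<beta> < k" "\<And>y. \<not> joined H (M \<beta>) v y" using missing[of v] uv by auto
      have "\<alpha> \<noteq> \<beta>" using stuck M \<alpha> \<beta> unfolding stuck_def by blast
      obtain s where s: "alternating H (M \<alpha>) (M \<beta>) s" "s ! 0 = u" "s ! (length s - 1) = v"
          "odd (length s)"
        using kempe_path[OF M stuck \<alpha>(1) \<beta>(1) \<open>\<alpha> \<noteq> \<beta>\<close> \<alpha>(2) \<beta>(2)] by blast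
      have "length s \<noteq> 1" using s uv(2) by auto
      then have len: "3 \<le> length s" using s(4) by presburger
      have "joined H (medges H) (s ! i) (s ! (Suc i mod length s))" if "i < length s" for i
      proof (cases "Suc i < length s")
        case True
        then show ?thesis
          using alternating_joined[OF s(1), of i] match \<alpha>(1) \<beta>(1) unfolding matching_def by simp
      next
        case False
        \<comment> \<open>The circuit is closed by \<open>e\<close> itself.\<close>
        then have "Suc i = length s" using that by simp
        then have "i = length s - 1" "Suc i mod length s = 0" by auto
        then have "s ! i = v" "s ! (Suc i mod length s) = u" using s(2,3) by simp_all
        then show ?thesis
          using e(1) uv(1) unfolding joined_def by (metis insert_commute)
      qed
      then have circuit: "odd_circuit H s"
        using s(1,4) len unfolding odd_circuit_def alternating_def by blast
      obtain j where j: "length s = 2 * j + 1" using s(4) by (auto elim: oddE)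
      define F where "F = {f \<in> medges H. ends H f \<subseteq> set s}"
      have card_s: "card (set s) = 2 * j + 1"
        using s(1) j distinct_card unfolding alternating_def by metis
      \<comment> \<open>The edges of colour \<open>i\<close> within \<open>set s\<close> cover all
        of its \<open>2 * j + 1\<close> vertices except at most one.\<close>
      have "j \<le> card (M i \<inter> F)" if i: "i < k" for i
      proof -
        obtain r where r: "\<And>x. x \<in> set s \<Longrightarrow> x \<noteq> r \<Longrightarrow> \<exists>y\<in>set s. joined H (M i) x y"
          using kempe_colour[OF ef M stuck \<alpha>(1) \<beta>(1) \<open>\<alpha> \<noteq> \<beta>\<close> \<alpha>(2) \<beta>(2) circuit s(1-3) i] by blast
        have fin: "finite (M i \<inter> F)" using finite_matching[OF match[OF i]] by blast
        have sub: "M i \<subseteq> medges H" using match[OF i] unfolding matching_def by blast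
        have "set s \<subseteq> insert r (\<Union>f\<in>M i \<inter> F. ends H f)"
        proof
          fix x assume x: "x \<in> set s"
          show "x \<in> insert r (\<Union>f\<in>M i \<inter> F. ends H f)"
          proof (cases "x = r")
            case False
            then obtain y f where "y \<in> set s" "f \<in> M i" "ends H f = {x, y}"
              using r[OF x] unfolding joined_def by blast
            then have "f \<in> M i \<inter> F" "x \<in> ends H f" using x sub unfolding F_def by auto
            then show ?thesis by blast
          qed simp
        qed
        moreover have fin': "finite (\<Union>f\<in>M i \<inter> F. ends H f)"
          using fin sub finite_ends by blast
        ultimately have "card (set s) \<le> card (insert r (\<Union>f\<in>M i \<inter> F. ends H f))"
          by (intro card_mono) auto
        also have "\<dots> \<le> Suc (card (\<Union>f\<in>M i \<inter> F. ends H f))"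
          using fin' by (simp add: card_insert_if)
        also have "card (\<Union>f\<in>M i \<inter> F. ends H f) \<le> (\<Sum>f\<in>M i \<inter> F. card (ends H f))"
          using fin by (rule card_UN_le)
        also have "\<dots> = 2 * card (M i \<inter> F)"
          using card_ends sub by (simp add: subset_iff)
        finally show ?thesis using card_s by simp
      qed
      \<comment> \<open>Summed over the colours, the coloured copies already exhaust the bound for
        \<open>set s\<close>; the copy of \<open>e\<close> set aside exceeds it.\<close>
      then have "(\<Sum>i<k. j) \<le> (\<Sum>i<k. card (M i \<inter> F))" by (intro sum_mono) auto
      moreover have F: "F \<subseteq> medges H" unfolding F_def by blast
      ultimately have "k * j \<le> (\<Sum>f\<in>F. c' f)" using proper_sum[OF M F] by simp
      moreover have "s ! 0 \<in> set s" "s ! (length s - 1) \<in> set s" using len by (auto intro!: nth_mem)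
      then have "e \<in> F" using e(1) uv(1) s(2,3) unfolding F_def by auto
      ultimately have "k * j < (\<Sum>f\<in>F. c f)" using c'_less[OF _ F] by fastforce
      then have "k * (2 * j) < 2 * (\<Sum>f\<in>F. c f)" by simp
      then show False using less.prems(2)[of "set s"] card_s unfolding F_def by simp
    qed
  qed
qed

section \<open>Edge colourings and the two covering programs\<close>

lemma finite_stable: "finite {S. stable_set (line_graph H) S \<and> P S}"
  by (rule finite_subset[of _ "Pow (medges H)"])
    (auto simp: stable_set_line_graph matching_def finite_medges)

text \<open>Weak duality: the incidences between edges of \<open>F\<close> and stable sets, weighted
  by \<open>y\<close>, are counted in two ways.\<close>

lemma covering_bound:
  fixes y :: "'e set \<Rightarrow> rat"
  assumes y: "y \<in> coverings (line_graph H) c" and F: "F \<subseteq> medges H"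
    and m: "\<And>S. matching H S \<Longrightarrow> card (S \<inter> F) \<le> m"
  shows "of_nat (\<Sum>f\<in>F. c f) \<le> of_nat m * (\<Sum>S | stable_set (line_graph H) S. y S)"
proof -
  define T where "T = {S. stable_set (line_graph H) S}"
  have y0: "0 \<le> y S" if "S \<in> T" for S
    using y that unfolding coverings_def T_def by blast
  have T: "finite T" using finite_stable[of "\<lambda>_. True"] unfolding T_def by simp
  have fin: "finite F" using F finite_medges finite_subset by blast
  have "of_nat (\<Sum>f\<in>F. c f) \<le> (\<Sum>f\<in>F. \<Sum>S\<in>{S \<in> T. f \<in> S}. y S)"
    unfolding of_nat_sum
  proof (rule sum_mono)
    fix f assume "f \<in> F"
    then have "f \<in> verts (line_graph H)" using F by (auto simp: line_graph_def)
    then show "of_nat (c f) \<le> (\<Sum>S\<in>{S \<in> T. f \<in> S}. y S)"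
      using y unfolding coverings_def T_def by simp
  qed
  also have "\<dots> = (\<Sum>S\<in>T. \<Sum>f\<in>{f \<in> F. f \<in> S}. y S)"
    by (rule sum.swap_restrict[OF fin T])
  also have "\<dots> = (\<Sum>S\<in>T. of_nat (card (S \<inter> F)) * y S)"
  proof (rule sum.cong[OF refl])
    fix S
    have "{f \<in> F. f \<in> S} = S \<inter> F" by auto
    then show "(\<Sum>f\<in>{f \<in> F. f \<in> S}. y S) = of_nat (card (S \<inter> F)) * y S" by simp
  qed
  also have "\<dots> \<le> (\<Sum>S\<in>T. of_nat m * y S)"
    using m y0 by (intro sum_mono mult_right_mono) (auto simp: T_def stable_set_line_graph)
  finally show ?thesis unfolding T_def by (simp add: sum_distrib_left)
qed

lemma coverings_nonempty: "coverings (line_graph H) c \<noteq> ({} :: ('e set \<Rightarrow> 'r::linordered_semidom) set)"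
proof -
  \<comment> \<open>Every stable set is taken as often as the total weight; the singletons alone
    then cover each edge often enough.\<close>
  define y :: "'e set \<Rightarrow> 'r" where "y S = of_nat (\<Sum>f\<in>medges H. c f)" for S
  have y_nonneg: "0 \<le> y S" for S
    unfolding y_def by (rule of_nat_0_le_iff)
  have "of_nat (c f) \<le> (\<Sum>S | stable_set (line_graph H) S \<and> f \<in> S. y S)" if "f \<in> medges H" for f
  proof -
    have "c f \<le> (\<Sum>f\<in>medges H. c f)" using that finite_medges by (intro member_le_sum) auto
    then have "of_nat (c f) \<le> y {f}" unfolding y_def by (simp only: of_nat_le_iff)
    also have "\<dots> \<le> (\<Sum>S | stable_set (line_graph H) S \<and> f \<in> S. y S)"
      using that by (intro member_le_sum finite_stable)
        (use y_nonneg in \<open>auto simp: stable_set_line_graph matching_def\<close>)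
    finally show ?thesis .
  qed
  then have "y \<in> coverings (line_graph H) c"
    using y_nonneg unfolding coverings_def by (simp add: line_graph_def)
  then show ?thesis by blast
qed

lemma chi_f_bound:
  assumes F: "F \<subseteq> medges H" and m: "\<And>S. matching H S \<Longrightarrow> card (S \<inter> F) \<le> m"
  shows "real (\<Sum>f\<in>F. c f) \<le> real m * chi_f (line_graph H) c"
proof -
  have bound: "real (\<Sum>f\<in>F. c f) \<le> real m * real_of_rat (\<Sum>S | stable_set (line_graph H) S. y S)"
    if "y \<in> coverings (line_graph H) c" for y
  proof -
    have "real_of_rat (of_nat (\<Sum>f\<in>F. c f)) \<le>
        real_of_rat (of_nat m * (\<Sum>S | stable_set (line_graph H) S. y S))"
      using covering_bound[OF that F m] by (simp only: of_rat_less_eq)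
    then show ?thesis by (simp only: of_rat_mult of_rat_of_nat_eq)
  qed
  obtain y0 :: "'e set \<Rightarrow> rat" where y0: "y0 \<in> coverings (line_graph H) c"
    using coverings_nonempty by blast
  show ?thesis
  \<comment> \<open>The passage to the infimum divides by \<open>m\<close>, so zero is treated
    apart.\<close>
  proof (cases "m = 0")
    case True
    then show ?thesis using bound[OF y0] by simp
  next
    case False
    have "real (\<Sum>f\<in>F. c f) / real m \<le> chi_f (line_graph H) c"
      unfolding chi_f_def
    proof (rule cINF_greatest[OF coverings_nonempty])
      fix y :: "'e set \<Rightarrow> rat" assume "y \<in> coverings (line_graph H) c"
      from bound[OF this] show "real (\<Sum>f\<in>F. c f) / real m \<le>
          real_of_rat (\<Sum>S | stable_set (line_graph H) S. y S)"
        using False by (simp only: field_simps)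
    qed
    then show ?thesis using False by (simp add: field_simps)
  qed
qed

text \<open>The integral minimum is attained, and an optimal integral covering is also a rational
  one.\<close>

lemma chi_f_le_chi: "chi_f (line_graph H) c \<le> real (chi (line_graph H) c)"
proof -
  have "chi (line_graph H) c \<in> (\<lambda>y. \<Sum>S | stable_set (line_graph H) S. y S) ` coverings (line_graph H) c"
    unfolding chi_def using coverings_nonempty by (intro Inf_nat_def1) simp
  then obtain y :: "'e set \<Rightarrow> nat" where y: "y \<in> coverings (line_graph H) c"
    "chi (line_graph H) c = (\<Sum>S | stable_set (line_graph H) S. y S)"
    by blast
  define z :: "'e set \<Rightarrow> rat" where "z S = of_nat (y S)" for S
  have z: "z \<in> coverings (line_graph H) c"
    using y(1) unfolding coverings_def z_def
    by (simp flip: of_nat_sum)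
  have "bdd_below ((\<lambda>y. real_of_rat (\<Sum>S | stable_set (line_graph H) S. y S)) `
      coverings (line_graph H) c)"
    by (rule bdd_belowI2[of _ 0]) (auto simp: coverings_def intro!: sum_nonneg)
  then have "chi_f (line_graph H) c \<le> real_of_rat (\<Sum>S | stable_set (line_graph H) S. z S)"
    unfolding chi_f_def by (rule cINF_lower[OF _ z])
  also have "\<dots> = real (chi (line_graph H) c)"
    unfolding y(2) z_def by (simp flip: of_nat_sum)
  finally show ?thesis .
qed

lemma chi_le_if_proper:
  assumes M: "proper H k c M"
  shows "chi (line_graph H) c \<le> k"
proof -
  \<comment> \<open>Coverings are indexed by stable sets, so colours with equal classes are counted
    together.\<close>
  define y where "y S = card {i. i < k \<and> M i = S}" for S
  have match: "stable_set (line_graph H) (M i)" if "i < k" for i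
    using M that unfolding proper_def stable_set_line_graph by blast
  have fibres: "(\<Sum>S\<in>T. y S) = card {i. i < k \<and> M i \<in> T}" if "finite T" for T
  proof -
    have "card (\<Union>S\<in>T. {i. i < k \<and> M i = S}) = (\<Sum>S\<in>T. card {i. i < k \<and> M i = S})"
      using that by (intro card_UN_disjoint) auto
    moreover have "(\<Union>S\<in>T. {i. i < k \<and> M i = S}) = {i. i < k \<and> M i \<in> T}" by auto
    ultimately show ?thesis unfolding y_def by simp
  qed
  have "(\<Sum>S | stable_set (line_graph H) S \<and> v \<in> S. y S) = c v" if "v \<in> medges H" for v
  proof -
    have "{i. i < k \<and> M i \<in> {S. stable_set (line_graph H) S \<and> v \<in> S}} = {i. i < k \<and> v \<in> M i}"
      using match by auto
    then show ?thesis
      using fibres[OF finite_stable[of "\<lambda>S. v \<in> S"]] M that unfolding proper_def by simp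
  qed
  then have "y \<in> coverings (line_graph H) c"
    unfolding coverings_def by (auto simp: line_graph_def)
  then have "chi (line_graph H) c \<le> (\<Sum>S | stable_set (line_graph H) S. y S)"
    unfolding chi_def by (intro cINF_lower) auto
  also have "\<dots> = k"
  proof -
    have "{i. i < k \<and> M i \<in> {S. stable_set (line_graph H) S}} = {..<k}"
      using match by auto
    then show ?thesis using fibres[of "{S. stable_set (line_graph H) S}"] finite_stable[of "\<lambda>_. True"]
      by simp
  qed
  finally show ?thesis .
qed

lemma integer_round_up_if_ear_free:
  assumes ef: "ear_free H"
  shows "integer_round_up (line_graph H)"
  unfolding integer_round_up_def
proof
  fix c :: "'e \<Rightarrow> nat"
  define k where "k = nat \<lceil>chi_f (line_graph H) c\<rceil>"
  \<comment> \<open>The empty set of edges shows that the fractional value is nonnegative, so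
    \<open>nat\<close> does not truncate its ceiling.\<close>
  have "real (\<Sum>f\<in>{}. c f) \<le> real 1 * chi_f (line_graph H) c"
    by (rule chi_f_bound) auto
  then have nonneg: "0 \<le> chi_f (line_graph H) c" by simp
  then have k: "int k = \<lceil>chi_f (line_graph H) c\<rceil>" "chi_f (line_graph H) c \<le> real k"
    unfolding k_def by (auto simp: real_nat_ceiling_ge)
  have bound: "(\<Sum>f\<in>F. c f) \<le> m * k"
    if "F \<subseteq> medges H" "\<And>S. matching H S \<Longrightarrow> card (S \<inter> F) \<le> m" for F m
  proof -
    have "real (\<Sum>f\<in>F. c f) \<le> real m * real k"
      using chi_f_bound[OF that, of c] k(2) by (meson mult_left_mono of_nat_0_le_iff order_trans)
    then have "real (\<Sum>f\<in>F. c f) \<le> real (m * k)" by (simp only: of_nat_mult)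
    then show ?thesis by (simp only: of_nat_le_iff)
  qed
  have "\<exists>M. proper H k c M"
  proof (rule proper_exists[OF ef])
    fix x
    define F where "F = {f \<in> medges H. x \<in> ends H f}"
    have "card (S \<inter> F) \<le> 1" if "matching H S" for S
    proof -
      have "\<forall>e\<in>S \<inter> F. \<forall>f\<in>S \<inter> F. e = f"
        using that unfolding matching_def F_def by blast
      then show ?thesis
        using card_le_Suc0_iff_eq[of "S \<inter> F"] finite_matching[OF that] by simp
    qed
    moreover have "F \<subseteq> medges H" unfolding F_def by blast
    ultimately have "(\<Sum>f\<in>F. c f) \<le> 1 * k" by (intro bound)
    then show "(\<Sum>f | f \<in> medges H \<and> x \<in> ends H f. c f) \<le> k"
      unfolding F_def by simp
  next
    fix U :: "'v set" assume U: "finite U" "odd (card U)"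
    define F where "F = {f \<in> medges H. ends H f \<subseteq> U}"
    have "card (S \<inter> F) \<le> (card U - 1) div 2" if "matching H S" for S
    proof -
      have "2 * card (S \<inter> F) \<le> card U"
        by (intro card_matching_within[OF that _ U(1)]) (auto simp: F_def)
      then show ?thesis using U(2) by presburger
    qed
    moreover have "F \<subseteq> medges H" unfolding F_def by blast
    ultimately have "(\<Sum>f\<in>F. c f) \<le> (card U - 1) div 2 * k" by (intro bound)
    then have "(\<Sum>f\<in>F. c f) \<le> k * ((card U - 1) div 2)" by (simp only: mult.commute)
    then have "2 * (\<Sum>f\<in>F. c f) \<le> k * (2 * ((card U - 1) div 2))"
      by simp
    then show "2 * (\<Sum>f | f \<in> medges H \<and> ends H f \<subseteq> U. c f) \<le> k * (card U - 1)"
      using U(2) unfolding F_def by simp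
  qed
  then have "chi (line_graph H) c \<le> k" using chi_le_if_proper by blast
  moreover have "\<lceil>chi_f (line_graph H) c\<rceil> \<le> int (chi (line_graph H) c)"
    using chi_f_le_chi by (simp add: ceiling_le_iff)
  ultimately show "int (chi (line_graph H) c) = \<lceil>chi_f (line_graph H) c\<rceil>"
    using k(1) by simp
qed

end

theorem theorem3:
  fixes H :: "('v, 'e) multigraph"
    and G :: "'e sgraph"
  assumes "multigraph H"
    and "G = line_graph H"
    and "h_perfect G"
  shows "integer_round_up G"
proof -
  interpret multigraph H by fact
  show ?thesis
    using ear_free_if_h_perfect integer_round_up_if_ear_free assms(2,3) by blast
qed

end
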